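(* There exists a universal constant $K>0$ such that the following holds. Let $d\ge1$, $\varepsilon>0$ and $T\ge K\cdot\frac{d}{\varepsilon^2}$. There is an algorithm which, given one copy each of unknown $d$-dimensional quantum states $\rho_1,\dots,\rho_T$ (i.e., given the state $\rho_1\otimes\cdots\otimes\rho_T$), distinguishes with probability at least $0.99$ the case $\rho_{\mathrm{avg}}=\frac{I}{d}$ from the case $D_{\mathrm{tr}}(\rho_{\mathrm{avg}},\frac{I}{d})>\varepsilon$, where $\rho_{\mathrm{avg}}=\frac1T\sum_{t=1}^T\rho_t$.
   Context: Quantum states are $d\times d$ density matrices. $D_{\mathrm{tr}}(\rho,\sigma)=\frac12\|\rho-\sigma\|_1$ (trace norm) is the trace distance. The algorithm may apply any quantum measurement to $\rho_1\otimes\cdots\otimes\rho_T$ (chosen depending on $d,\varepsilon,T$ only) and outputs accept/reject; "distinguishes with probability at least $0.99$" means it accepts with probability at least $0.99$ in the first case and rejects with probability at least $0.99$ in the second case. *)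

theory Defs
  imports "Jordan_Normal_Form.Schur_Decomposition"
begin

text \<open>Matrices are JNF complex matrices (dimensions are values, so d and T can vary).\<close>

definition mtrace :: "complex mat \<Rightarrow> complex" where
  "mtrace A = (\<Sum>i<dim_row A. A $$ (i, i))"

definition psd_mat :: "nat \<Rightarrow> complex mat \<Rightarrow> bool" where
  "psd_mat n A \<longleftrightarrow> A \<in> carrier_mat n n \<and>
     (\<forall>v \<in> carrier_vec n.
        let q = (\<Sum>i<n. \<Sum>j<n. cnj (v $ i) * A $$ (i, j) * v $ j) in Im q = 0 \<and> Re q \<ge> 0)"

definition density_mat :: "nat \<Rightarrow> complex mat \<Rightarrow> bool" where
  "density_mat d \<rho> \<longleftrightarrow> psd_mat d \<rho> \<and> mtrace \<rho> = 1"

definition kron :: "complex mat \<Rightarrow> complex mat \<Rightarrow> complex mat" where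
  "kron A B = mat (dim_row A * dim_row B) (dim_col A * dim_col B)
     (\<lambda>(i, j). A $$ (i div dim_row B, j div dim_col B) * B $$ (i mod dim_row B, j mod dim_col B))"

text \<open>rho_0 (x) rho_1 (x) ... (x) rho_(T-1)  (indices shifted by one w.r.t. the paper).\<close>
definition tensor_all :: "nat \<Rightarrow> (nat \<Rightarrow> complex mat) \<Rightarrow> complex mat" where
  "tensor_all T \<rho> = foldr (\<lambda>t M. kron (\<rho> t) M) [0..<T] (1\<^sub>m 1)"

text \<open>Trace norm: sum of the singular values, i.e. of the square roots of the
  eigenvalues (with multiplicity) of A^* A.\<close>
definition trace_norm :: "complex mat \<Rightarrow> real" where
  "trace_norm A = (\<Sum>x\<in>#proots (char_poly (mat_adjoint A * A)). sqrt (Re x))"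

definition trace_dist :: "complex mat \<Rightarrow> complex mat \<Rightarrow> real" where
  "trace_dist \<rho> \<sigma> = trace_norm (\<rho> - \<sigma>) / 2"

definition rho_avg :: "nat \<Rightarrow> nat \<Rightarrow> (nat \<Rightarrow> complex mat) \<Rightarrow> complex mat" where
  "rho_avg d T \<rho> = mat d d (\<lambda>(i, j). (\<Sum>t<T. \<rho> t $$ (i, j)) / of_nat T)"

definition max_mixed :: "nat \<Rightarrow> complex mat" where
  "max_mixed d = (1 / of_nat d) \<cdot>\<^sub>m 1\<^sub>m d"

text \<open>Two-outcome measurement (accept effect M, reject effect I - M): 0 <= M <= I.\<close>
definition accept_effect :: "nat \<Rightarrow> complex mat \<Rightarrow> bool" where
  "accept_effect n M \<longleftrightarrow> psd_mat n M \<and> psd_mat n (1\<^sub>m n - M)"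

definition accept_prob :: "complex mat \<Rightarrow> complex mat \<Rightarrow> real" where
  "accept_prob M \<rho> = Re (mtrace (M * \<rho>))"

end

theory Submission
  imports Defs "HOL-Analysis.L2_Norm"
begin

text \<open>Let \<open>X\<close> be the sum over all ordered pairs \<open>s \<noteq> t\<close> of the operators swapping the tensor factors
  \<open>s\<close> and \<open>t\<close>, and let \<open>F\<close> be the squared Frobenius norm of \<open>T (\<rho>\<^sub>a\<^sub>v\<^sub>g - I/d)\<close>. Then
  \<open>E X - T\<^sup>2/d = F - (\<Sum>t. tr (\<rho>\<^sub>t\<^sup>2))\<close> lies between \<open>F - T\<close> and \<open>F\<close>, while the variance of \<open>X\<close> is at
  most \<open>8TF + 20T\<^sup>2\<close>: only pairs of swaps sharing a factor contribute to it. If \<open>\<rho>\<^sub>a\<^sub>v\<^sub>g = I/d\<close>, then \<open>X\<close> is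
  within \<open>O(T)\<close> of \<open>T\<^sup>2/d\<close>; if the trace distance exceeds \<open>\<epsilon>\<close>, then \<open>F > 4 \<epsilon>\<^sup>2 T\<^sup>2/d \<ge> 4KT\<close> by
  Cauchy-Schwarz, so \<open>X\<close> is far from \<open>T\<^sup>2/d\<close>. Instead of a spectral projection of \<open>X\<close>, the accepting effect
  is the resolvent \<open>(I + Y\<^sup>2)\<^sup>-\<^sup>1\<close> with \<open>Y = (X - T\<^sup>2/d) / (50T)\<close>.\<close>

section \<open>Hermitian kernels and the resolvent effect\<close>

text \<open>The resolvent serves both error bounds through two scalar inequalities: 1 - 1/(1 + y^2)
  \<le> y^2, and \<mu>^2/(1 + y^2) \<le> 2 ((y - \<mu>)^2 + 1). They involve only the first two
  moments of X and are proved for operators one vector at a time; a mixed state enters as a sum of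
  rank-one kernels from a Cholesky factorisation, so no eigenvectors of X or of the states are
  needed. The obstacle is the variance. About 4 T^3 ordered pairs of swaps share exactly one factor,
  and bounding their covariances separately gives order T^3 where T^2 is required. For a fixed
  shared factor c, however, the covariances add up, over both partners, essentially to the variance
  in \<rho>_c of one observable, the sum of the other states. A multiple of the identity may be
  subtracted from it, which leaves T (\<rho>_avg - I/d) up to \<rho>_c; hence a bound in F with no
  dimension factor.\<close>

definition ip :: "'i set \<Rightarrow> ('i \<Rightarrow> complex) \<Rightarrow> ('i \<Rightarrow> complex) \<Rightarrow> complex" where
  "ip I u v = (\<Sum>i\<in>I. cnj (u i) * v i)"

definition nrm2 :: "'i set \<Rightarrow> ('i \<Rightarrow> complex) \<Rightarrow> real" where
  "nrm2 I u = (\<Sum>i\<in>I. (cmod (u i))\<^sup>2)"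

text \<open>Kernels live on arbitrary index sets: the Cholesky induction adds one index at a time,
  and the swap operators are most naturally indexed by functions from factors to basis labels, not
  by numbers.\<close>

definition app :: "'i set \<Rightarrow> ('i \<Rightarrow> 'i \<Rightarrow> complex) \<Rightarrow> ('i \<Rightarrow> complex) \<Rightarrow> 'i \<Rightarrow> complex" where
  "app I A v = (\<lambda>i. \<Sum>j\<in>I. A i j * v j)"

definition hermitian_on :: "'i set \<Rightarrow> ('i \<Rightarrow> 'i \<Rightarrow> complex) \<Rightarrow> bool" where
  "hermitian_on I A \<longleftrightarrow> (\<forall>i\<in>I. \<forall>j\<in>I. A i j = cnj (A j i))"

lemma ip_cong:
  assumes "\<And>i. i \<in> I \<Longrightarrow> u i = u' i" "\<And>i. i \<in> I \<Longrightarrow> v i = v' i"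
  shows "ip I u v = ip I u' v'"
  unfolding ip_def using assms by (intro sum.cong) auto

lemma nrm2_cong: "(\<And>i. i \<in> I \<Longrightarrow> u i = u' i) \<Longrightarrow> nrm2 I u = nrm2 I u'"
  unfolding nrm2_def by (intro sum.cong) auto

lemma app_cong:
  assumes "\<And>j. j \<in> I \<Longrightarrow> v j = v' j"
  shows "app I A v i = app I A v' i"
  unfolding app_def using assms by (intro sum.cong) auto

lemma ip_self: "ip I u u = of_real (nrm2 I u)"
  unfolding ip_def nrm2_def
  by (simp add: complex_norm_square mult.commute flip: of_real_power)

lemma nrm2_nonneg: "0 \<le> nrm2 I u"
  unfolding nrm2_def by (simp add: sum_nonneg)

lemma ip_add_right: "ip I u (\<lambda>i. v i + w i) = ip I u v + ip I u w"
  unfolding ip_def by (simp add: algebra_simps sum.distrib)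

lemma ip_add_left: "ip I (\<lambda>i. v i + w i) u = ip I v u + ip I w u"
  unfolding ip_def by (simp add: algebra_simps sum.distrib)

lemma ip_smult_right: "ip I u (\<lambda>i. c * v i) = c * ip I u v"
  unfolding ip_def by (simp add: algebra_simps sum_distrib_left)

lemma ip_smult_left: "ip I (\<lambda>i. c * v i) u = cnj c * ip I v u"
  unfolding ip_def by (simp add: algebra_simps sum_distrib_left)

lemma ip_app:
  assumes "hermitian_on I A"
  shows "ip I (app I A u) v = ip I u (app I A v)"
proof -
  have "ip I (app I A u) v = (\<Sum>i\<in>I. \<Sum>j\<in>I. cnj (A i j) * cnj (u j) * v i)"
    unfolding ip_def app_def by (simp add: sum_distrib_right)
  also have "\<dots> = (\<Sum>j\<in>I. \<Sum>i\<in>I. cnj (A i j) * cnj (u j) * v i)"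
    by (rule sum.swap)
  also have "\<dots> = (\<Sum>j\<in>I. \<Sum>i\<in>I. cnj (u j) * (A j i * v i))"
  proof (intro sum.cong refl)
    fix i j assume "i \<in> I" "j \<in> I"
    hence "cnj (A i j) = A j i" using assms unfolding hermitian_on_def by metis
    thus "cnj (A i j) * cnj (u j) * v i = cnj (u j) * (A j i * v i)" by simp
  qed
  also have "\<dots> = ip I u (app I A v)"
    unfolding ip_def app_def by (simp add: sum_distrib_left)
  finally show ?thesis .
qed

lemma cmod_sum_mult_le:
  "cmod (\<Sum>i\<in>I. a i * b i) \<le> sqrt (\<Sum>i\<in>I. (cmod (a i))\<^sup>2) * sqrt (\<Sum>i\<in>I. (cmod (b i))\<^sup>2)"
proof -
  have "cmod (\<Sum>i\<in>I. a i * b i) \<le> (\<Sum>i\<in>I. \<bar>cmod (a i)\<bar> * \<bar>cmod (b i)\<bar>)"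
    by (rule order_trans[OF norm_sum]) (simp add: norm_mult)
  also have "\<dots> \<le> L2_set (\<lambda>i. cmod (a i)) I * L2_set (\<lambda>i. cmod (b i)) I"
    by (rule L2_set_mult_ineq)
  finally show ?thesis by (simp add: L2_set_def)
qed

lemma cmod_ip_le: "cmod (ip I u v) \<le> sqrt (nrm2 I u) * sqrt (nrm2 I v)"
  using cmod_sum_mult_le[of "\<lambda>i. cnj (u i)" v I] unfolding ip_def nrm2_def by simp

lemma nrm2_add_le: "nrm2 I (\<lambda>i. u i + v i) \<le> 2 * nrm2 I u + 2 * nrm2 I v"
proof -
  have "(cmod (u i + v i))\<^sup>2 \<le> 2 * (cmod (u i))\<^sup>2 + 2 * (cmod (v i))\<^sup>2" for i
  proof -
    have "(cmod (u i + v i))\<^sup>2 \<le> (cmod (u i) + cmod (v i))\<^sup>2"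
      by (intro power_mono norm_triangle_ineq) auto
    also have "\<dots> \<le> 2 * (cmod (u i))\<^sup>2 + 2 * (cmod (v i))\<^sup>2"
      using sum_squares_bound[of "cmod (u i)" "cmod (v i)"] by (simp add: power2_sum)
    finally show ?thesis .
  qed
  hence "nrm2 I (\<lambda>i. u i + v i) \<le> (\<Sum>i\<in>I. 2 * (cmod (u i))\<^sup>2 + 2 * (cmod (v i))\<^sup>2)"
    unfolding nrm2_def by (intro sum_mono)
  thus ?thesis by (simp add: nrm2_def sum.distrib sum_distrib_left)
qed

lemma nrm2_eq_0: "finite I \<Longrightarrow> nrm2 I u = 0 \<Longrightarrow> i \<in> I \<Longrightarrow> u i = 0"
  unfolding nrm2_def by (subst (asm) sum_nonneg_eq_0_iff) auto

text \<open>I + Y^2 is injective because its quadratic form at w is |w|^2 + |Y w|^2; a square matrix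
  with trivial kernel is invertible. The inverse is recorded only through its action, the form in
  which the bounds below consume it.\<close>

lemma resolvent_exists:
  fixes n :: nat
  assumes herm: "hermitian_on {..<n} Y"
  obtains R where "\<And>u i. i < n \<Longrightarrow>
     u i = app {..<n} R u i + app {..<n} Y (app {..<n} Y (app {..<n} R u)) i"
proof -
  let ?I = "{..<n}"
  define Z where "Z = mat n n (\<lambda>(i, j). (if i = j then 1 else 0) + (\<Sum>k<n. Y i k * Y k j))"
  have Z: "Z \<in> carrier_mat n n" unfolding Z_def by simp
  have Zapp: "(\<Sum>j<n. Z $$ (i, j) * w j) = w i + app ?I Y (app ?I Y w) i" if "i < n" for i w
  proof -
    have "(\<Sum>j<n. Z $$ (i, j) * w j) = (\<Sum>j<n. (if i = j then w j else 0) + (\<Sum>k<n. Y i k * Y k j * w j))"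
      unfolding Z_def using that
      by (intro sum.cong refl) (auto simp: distrib_right sum_distrib_right)
    also have "\<dots> = w i + (\<Sum>j<n. \<Sum>k<n. Y i k * Y k j * w j)"
      using that by (simp add: sum.distrib)
    also have "(\<Sum>j<n. \<Sum>k<n. Y i k * Y k j * w j) = (\<Sum>k<n. \<Sum>j<n. Y i k * Y k j * w j)"
      by (rule sum.swap)
    also have "\<dots> = app ?I Y (app ?I Y w) i"
      unfolding app_def by (simp add: sum_distrib_left mult.assoc)
    finally show ?thesis .
  qed
  have "det Z \<noteq> 0"
  proof
    assume "det Z = 0"
    then obtain v where v: "v \<in> carrier_vec n" "v \<noteq> 0\<^sub>v n" "Z *\<^sub>v v = 0\<^sub>v n"
      using det_0_iff_vec_prod_zero[OF Z] by blast
    let ?w = "\<lambda>i. v $ i"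
    have eq: "?w i + app ?I Y (app ?I Y ?w) i = 0" if "i < n" for i
    proof -
      have "(Z *\<^sub>v v) $ i = (\<Sum>j<n. Z $$ (i, j) * v $ j)"
        using that v(1) Z by (simp add: scalar_prod_def lessThan_atLeast0)
      thus ?thesis using Zapp[OF that, of ?w] v(3) that by simp
    qed
    have "0 = ip ?I ?w (\<lambda>i. ?w i + app ?I Y (app ?I Y ?w) i)"
      using eq by (simp add: ip_def)
    also have "\<dots> = of_real (nrm2 ?I ?w + nrm2 ?I (app ?I Y ?w))"
      by (simp add: ip_add_right ip_self ip_app[OF herm, symmetric])
    finally have "nrm2 ?I ?w + nrm2 ?I (app ?I Y ?w) = 0"
      by (metis of_real_eq_0_iff)
    hence "nrm2 ?I ?w = 0" using nrm2_nonneg[of ?I ?w] nrm2_nonneg[of ?I "app ?I Y ?w"] by linarith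
    hence "v $ i = 0" if "i < n" for i using nrm2_eq_0[of ?I ?w i] that by simp
    hence "v = 0\<^sub>v n" using v by (intro eq_vecI) auto
    thus False using v by simp
  qed
  from det_non_zero_imp_unit[OF Z this, of "()"] obtain B where
    B: "B \<in> carrier_mat n n" "Z * B = 1\<^sub>m n"
    unfolding Units_def by (auto simp: ring_mat_def)
  define R where "R = (\<lambda>i j. B $$ (i, j))"
  have "u i = app ?I R u i + app ?I Y (app ?I Y (app ?I R u)) i" if i: "i < n" for u i
  proof -
    have ZB: "(\<Sum>j<n. Z $$ (i, j) * B $$ (j, k)) = (if i = k then 1 else 0)" if "k < n" for k
    proof -
      have "(Z * B) $$ (i, k) = (\<Sum>j<n. Z $$ (i, j) * B $$ (j, k))"
        using i that Z B(1) by (simp add: scalar_prod_def lessThan_atLeast0)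
      thus ?thesis using B(2) i that by simp
    qed
    have "app ?I R u i + app ?I Y (app ?I Y (app ?I R u)) i = (\<Sum>j<n. Z $$ (i, j) * app ?I R u j)"
      by (rule Zapp[OF i, symmetric])
    also have "\<dots> = (\<Sum>j<n. \<Sum>k<n. Z $$ (i, j) * B $$ (j, k) * u k)"
      unfolding app_def R_def by (simp add: sum_distrib_left mult.assoc)
    also have "\<dots> = (\<Sum>k<n. \<Sum>j<n. Z $$ (i, j) * B $$ (j, k) * u k)"
      by (rule sum.swap)
    also have "\<dots> = (\<Sum>k<n. (if i = k then 1 else 0) * u k)"
      by (intro sum.cong refl) (simp add: ZB sum_distrib_right[symmetric])
    also have "\<dots> = (\<Sum>k<n. if i = k then u k else 0)"
      by (intro sum.cong) auto
    also have "\<dots> = u i" using i by simp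
    finally show ?thesis by simp
  qed
  thus ?thesis using that by blast
qed

text \<open>Here \<open>w = (I + Y\<^sup>2)\<^sup>-\<^sup>1 u\<close>. Every estimate follows from \<open>u = w + Y (Y w)\<close> alone, which
  avoids the spectral theorem.\<close>

lemma resolvent_bounds:
  assumes herm: "hermitian_on I Y"
    and w: "\<And>i. i \<in> I \<Longrightarrow> u i = w i + app I Y (app I Y w) i"
  shows "ip I u w = of_real (nrm2 I w + nrm2 I (app I Y w))"
    and "ip I u (\<lambda>i. u i - w i) = of_real (nrm2 I (app I Y w) + nrm2 I (app I Y (app I Y w)))"
    and "nrm2 I u - Re (ip I u w) \<le> nrm2 I (app I Y u)"
    and "0 < \<mu> \<Longrightarrow> \<mu>\<^sup>2 * Re (ip I u w) \<le> 2 * (nrm2 I (\<lambda>i. app I Y u i - of_real \<mu> * u i) + nrm2 I u)"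
proof -
  let ?y = "app I Y w" and ?z = "app I Y (app I Y w)"
  have u: "ip I u v = ip I w v + ip I ?z v" for v
    using ip_cong[of I u "\<lambda>i. w i + ?z i" v v] w by (simp add: ip_add_left)
  have zw: "ip I ?z w = of_real (nrm2 I ?y)"
    by (simp add: ip_app[OF herm] flip: ip_self)
  have wz: "ip I w ?z = of_real (nrm2 I ?y)"
    by (simp add: ip_app[OF herm, symmetric] ip_self)
  show uw: "ip I u w = of_real (nrm2 I w + nrm2 I ?y)"
    by (simp add: u ip_self zw)
  have "ip I u (\<lambda>i. u i - w i) = ip I u ?z"
    using w by (intro ip_cong) auto
  also have "\<dots> = of_real (nrm2 I ?y + nrm2 I ?z)"
    by (simp add: u ip_self wz)
  finally show uuw: "ip I u (\<lambda>i. u i - w i) = of_real (nrm2 I ?y + nrm2 I ?z)" .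
  have Yu: "app I Y u i = ?y i + app I Y ?z i" for i
  proof -
    have "app I Y u i = app I Y (\<lambda>i. w i + ?z i) i" using w by (intro app_cong) auto
    thus ?thesis by (simp add: app_def algebra_simps sum.distrib)
  qed
  have uu: "nrm2 I u = Re (ip I u w) + nrm2 I ?y + nrm2 I ?z"
  proof -
    have "ip I u u = ip I u w + ip I u (\<lambda>i. u i - w i)"
      by (simp flip: ip_add_right)
    hence "of_real (nrm2 I u) = ip I u w + of_real (nrm2 I ?y + nrm2 I ?z)"
      by (simp only: ip_self uuw)
    from arg_cong[OF this, of Re] show ?thesis by simp
  qed
  have "complex_of_real (nrm2 I (app I Y u)) = ip I (\<lambda>i. ?y i + app I Y ?z i) (\<lambda>i. ?y i + app I Y ?z i)"
    unfolding ip_self[symmetric] by (rule ip_cong) (rule Yu)+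
  also have "\<dots> = of_real (nrm2 I ?y + 2 * nrm2 I ?z + nrm2 I (app I Y ?z))"
    by (simp add: ip_add_left ip_add_right ip_app[OF herm, of ?z ?y] ip_app[OF herm, of ?y ?z, symmetric] ip_self)
  finally have "nrm2 I (app I Y u) = nrm2 I ?y + 2 * nrm2 I ?z + nrm2 I (app I Y ?z)"
    by (simp only: of_real_eq_iff)
  \<comment> \<open>By \<open>uu\<close> the left side is |y|^2 + |z|^2; the right side exceeds it
    by |z|^2 + |Y z|^2.\<close>
  thus "nrm2 I u - Re (ip I u w) \<le> nrm2 I (app I Y u)"
    using uu nrm2_nonneg[of I ?z] nrm2_nonneg[of I "app I Y ?z"] by simp
  assume \<mu>: "0 < \<mu>"
  let ?d = "\<lambda>i. app I Y u i - of_real \<mu> * u i"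
  define s where "s = sqrt (Re (ip I u w))"
  have s0: "0 \<le> Re (ip I u w)" by (simp add: uw nrm2_nonneg)
  have s2: "s\<^sup>2 = Re (ip I u w)" "0 \<le> s" using s0 by (auto simp: s_def)
  have sw: "sqrt (nrm2 I w) \<le> s" "sqrt (nrm2 I ?y) \<le> s"
    by (auto simp: s_def uw nrm2_nonneg)
  \<comment> \<open>Split Y u into \<open>\<mu>\<close> u and the remainder \<open>?d\<close>, and
    pair with w. Since s^2 = |w|^2 + |Y w|^2, Cauchy-Schwarz bounds both resulting terms by a
    multiple of s, and one factor s cancels.\<close>
  have "ip I u ?y = ip I (app I Y u) w" by (simp add: ip_app[OF herm])
  also have "\<dots> = ip I (\<lambda>i. ?d i + of_real \<mu> * u i) w" by simp
  also have "\<dots> = ip I ?d w + of_real \<mu> * ip I u w"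
    by (simp only: ip_add_left ip_smult_left complex_cnj_complex_of_real)
  finally have "of_real \<mu> * ip I u w = ip I u ?y - ip I ?d w" by simp
  hence "Re (of_real \<mu> * ip I u w) = Re (ip I u ?y - ip I ?d w)" by simp
  hence "\<mu> * s\<^sup>2 = Re (ip I u ?y - ip I ?d w)" by (simp add: s2)
  also have "\<dots> \<le> cmod (ip I u ?y) + cmod (ip I ?d w)"
    by (rule order_trans[OF complex_Re_le_cmod norm_triangle_ineq4])
  also have "\<dots> \<le> sqrt (nrm2 I u) * sqrt (nrm2 I ?y) + sqrt (nrm2 I ?d) * sqrt (nrm2 I w)"
    by (intro add_mono cmod_ip_le)
  also have "\<dots> \<le> sqrt (nrm2 I u) * s + sqrt (nrm2 I ?d) * s"
    using sw by (intro add_mono mult_left_mono) (auto simp: nrm2_nonneg)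
  finally have "\<mu> * s\<^sup>2 \<le> (sqrt (nrm2 I u) + sqrt (nrm2 I ?d)) * s" by (simp add: algebra_simps)
  hence "\<mu> * s \<le> sqrt (nrm2 I u) + sqrt (nrm2 I ?d)"
    using s2(2) nrm2_nonneg[of I u] nrm2_nonneg[of I ?d]
    by (cases "s = 0") (auto simp: power2_eq_square)
  hence "(\<mu> * s)\<^sup>2 \<le> (sqrt (nrm2 I u) + sqrt (nrm2 I ?d))\<^sup>2"
    using \<mu> s2(2) by (intro power_mono) auto
  also have "\<dots> \<le> 2 * (nrm2 I ?d + nrm2 I u)"
    using sum_squares_bound[of "sqrt (nrm2 I u)" "sqrt (nrm2 I ?d)"]
    by (simp add: power2_sum nrm2_nonneg)
  finally show "\<mu>\<^sup>2 * Re (ip I u w) \<le> 2 * (nrm2 I ?d + nrm2 I u)"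
    by (simp add: power_mult_distrib s2)
qed

section \<open>Positive semidefinite kernels\<close>

definition psd_on :: "'i set \<Rightarrow> ('i \<Rightarrow> 'i \<Rightarrow> complex) \<Rightarrow> bool" where
  "psd_on I A \<longleftrightarrow> (\<forall>v. Im (ip I v (app I A v)) = 0 \<and> 0 \<le> Re (ip I v (app I A v)))"

lemma ip_app_insert:
  assumes "finite I" "x \<notin> I"
  shows "ip (insert x I) v (app (insert x I) A v) =
    cnj (v x) * A x x * v x + cnj (v x) * (\<Sum>j\<in>I. A x j * v j)
    + (\<Sum>i\<in>I. cnj (v i) * A i x) * v x + ip I v (app I A v)"
  using assms unfolding ip_def app_def
  by (simp add: algebra_simps sum.distrib sum_distrib_left sum_distrib_right)

lemma ip_app_cong:
  assumes "\<And>i. i \<in> I \<Longrightarrow> v i = v' i" "\<And>i j. i \<in> I \<Longrightarrow> j \<in> I \<Longrightarrow> A i j = A' i j"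
  shows "ip I v (app I A v) = ip I v' (app I A' v')"
  unfolding ip_def app_def using assms by (intro sum.cong arg_cong2[where f = "(*)"] arg_cong[where f = cnj]) auto

lemma ip_app_support:
  assumes "finite I" "J \<subseteq> I" "\<And>i. i \<in> I - J \<Longrightarrow> v i = 0"
  shows "ip I v (app I A v) = ip J v (app J A v)"
proof -
  have "ip I v (app I A v) = (\<Sum>i\<in>J. cnj (v i) * (\<Sum>j\<in>I. A i j * v j))"
    unfolding ip_def app_def by (rule sum.mono_neutral_right) (use assms in auto)
  also have "\<dots> = (\<Sum>i\<in>J. cnj (v i) * (\<Sum>j\<in>J. A i j * v j))"
    by (intro sum.cong arg_cong2[where f = "(*)"] refl sum.mono_neutral_right) (use assms in auto)
  finally show ?thesis by (simp add: ip_def app_def)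
qed

lemma psd_on_subset:
  assumes "psd_on I A" "finite I" "J \<subseteq> I"
  shows "psd_on J A"
  unfolding psd_on_def
proof
  fix v :: "'a \<Rightarrow> complex"
  let ?v = "\<lambda>i. if i \<in> J then v i else 0"
  have "ip I ?v (app I A ?v) = ip J ?v (app J A ?v)"
    by (rule ip_app_support) (use assms in auto)
  also have "\<dots> = ip J v (app J A v)" by (rule ip_app_cong) auto
  finally show "Im (ip J v (app J A v)) = 0 \<and> 0 \<le> Re (ip J v (app J A v))"
    using assms(1) unfolding psd_on_def by metis
qed

lemma psd_on_diag:
  assumes "psd_on I A" "finite I" "x \<in> I"
  shows "Im (A x x) = 0" "0 \<le> Re (A x x)"
proof -
  have "psd_on {x} A" by (rule psd_on_subset[OF assms(1,2)]) (use assms in auto)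
  from this[unfolded psd_on_def, rule_format, of "\<lambda>_. 1"]
  show "Im (A x x) = 0" "0 \<le> Re (A x x)" by (auto simp: ip_def app_def)
qed

lemma psd_on_quadratic:
  assumes "psd_on I A" "finite I" "x \<in> I" "y \<in> I" "x \<noteq> y"
  shows "Im (cnj a * A x x * a + cnj a * A x y * b + cnj b * A y x * a + cnj b * A y y * b) = 0"
    "0 \<le> Re (cnj a * A x x * a + cnj a * A x y * b + cnj b * A y x * a + cnj b * A y y * b)"
proof -
  have "psd_on {x, y} A" by (rule psd_on_subset[OF assms(1,2)]) (use assms in auto)
  from this[unfolded psd_on_def, rule_format, of "\<lambda>i. if i = x then a else b"]
  show "Im (cnj a * A x x * a + cnj a * A x y * b + cnj b * A y x * a + cnj b * A y y * b) = 0"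
    "0 \<le> Re (cnj a * A x x * a + cnj a * A x y * b + cnj b * A y x * a + cnj b * A y y * b)"
    using assms by (auto simp: ip_def app_def algebra_simps)
qed

text \<open>\<open>psd_on\<close> speaks of the quadratic form only, so symmetry comes by
  polarisation: the imaginary part of the form vanishes at the coefficient pairs (1, 1) and (1,
  i).\<close>

lemma psd_on_hermitian:
  assumes "psd_on I A" "finite I"
  shows "hermitian_on I A"
  unfolding hermitian_on_def
proof (intro ballI)
  fix x y assume xy: "x \<in> I" "y \<in> I"
  show "A x y = cnj (A y x)"
  proof (cases "x = y")
    case True
    thus ?thesis using psd_on_diag[OF assms xy(1)] by (auto simp: complex_eq_iff)
  next
    case False
    note q = psd_on_quadratic(1)[OF assms xy False] and d = psd_on_diag[OF assms]
    from q[of 1 1] q[of 1 \<i>] d[OF xy(1)] d[OF xy(2)] show ?thesis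
      by (auto simp: complex_eq_iff)
  qed
qed

text \<open>With a zero diagonal entry the form is affine in the coordinate at x, hence unbounded
  below unless the cross term vanishes.\<close>

lemma psd_on_zero_diag:
  assumes "psd_on I A" "finite I" "x \<in> I" "y \<in> I" "A x x = 0"
  shows "A x y = 0"
proof (cases "x = y")
  case False
  \<comment> \<open>Chosen so that the form takes the value \<open>A y y - 2 * r\<close>, whose real
    part is -1.\<close>
  define r where "r = (Re (A y y) + 1) / 2"
  have h: "A y x = cnj (A x y)"
    using psd_on_hermitian[OF assms(1,2)] assms(3,4) unfolding hermitian_on_def by blast
  show ?thesis
  proof (rule ccontr)
    assume nz: "A x y \<noteq> 0"
    define m where "m = (cmod (A x y))\<^sup>2"
    have m: "m > 0" "A x y * cnj (A x y) = of_real m"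
      using nz by (auto simp: m_def complex_norm_square simp flip: of_real_power)
    define a where "a = - of_real (r / m) * A x y"
    have "cnj a * A x x * a + cnj a * A x y * 1 + cnj 1 * A y x * a + cnj 1 * A y y * 1
        = A y y - of_real (2 * (r / m)) * (A x y * cnj (A x y))"
      by (simp add: a_def h assms(5) algebra_simps)
    also have "\<dots> = A y y - of_real (2 * r)"
      using m by (simp add: m(2))
    finally have "0 \<le> Re (A y y - of_real (2 * r))"
      using psd_on_quadratic(2)[OF assms(1-4) False, of a 1] by metis
    thus False by (simp add: r_def)
  qed
qed (use assms in simp)

text \<open>Cholesky factorisation: at each step the Schur complement of the diagonal entry \<open>A x x\<close>
  is again positive semidefinite.\<close>

lemma psd_on_factorization:
  assumes "finite I" "psd_on I A"
  shows "\<exists>c. \<forall>i\<in>I. \<forall>j\<in>I. A i j = (\<Sum>k\<in>I. c k i * cnj (c k j))"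
  using assms
proof (induction I arbitrary: A rule: finite_induct)
  case (insert x I)
  let ?I = "insert x I"
  note psd = \<open>psd_on ?I A\<close>
  have fin: "finite ?I" using insert by simp
  have herm: "A i j = cnj (A j i)" if "i \<in> ?I" "j \<in> ?I" for i j
    using psd_on_hermitian[OF psd fin] that unfolding hermitian_on_def by blast
  define a where "a = Re (A x x)"
  have a: "A x x = of_real a" "0 \<le> a"
    using psd_on_diag[OF psd fin, of x] by (auto simp: a_def complex_eq_iff)
  define s where "s = complex_of_real (sqrt a)"
  have s: "s * s = A x x" "cnj s = s"
    using a by (auto simp: s_def simp flip: of_real_mult)
  \<comment> \<open>If the pivot is 0 then its whole column vanishes, so the choice 0 still
    reproduces the column in \<open>bx\<close>.\<close>
  define b where "b i = (if a = 0 then 0 else A i x / s)" for i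
  have bx: "b i * cnj (b x) = A i x" if "i \<in> ?I" for i
  proof (cases "a = 0")
    case True
    hence "A x i = 0" using psd_on_zero_diag[OF psd fin, of x i] that a by simp
    hence "A i x = 0" using herm[of i x] that by simp
    thus ?thesis using True by (simp add: b_def)
  next
    case False
    hence "s \<noteq> 0" "A x x \<noteq> 0" using a by (auto simp: s_def)
    thus ?thesis using False herm[of x x] s by (simp add: b_def field_simps)
  qed
  define B where "B i j = A i j - b i * cnj (b j)" for i j
  have "psd_on I B"
    unfolding psd_on_def
  proof
    fix v
    define \<beta> where "\<beta> = (\<Sum>j\<in>I. A x j * v j)"
    have \<beta>': "(\<Sum>i\<in>I. cnj (v i) * A i x) = cnj \<beta>"
      unfolding \<beta>_def cnj_sum complex_cnj_mult
    proof (intro sum.cong refl)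
      fix i assume "i \<in> I"
      thus "cnj (v i) * A i x = cnj (A x i) * cnj (v i)" using herm[of i x] by simp
    qed
    \<comment> \<open>The minimiser of the form of A in the coordinate at x. The minimum is the form
      of the Schur complement B at v, so B inherits nonnegativity from A.\<close>
    define \<alpha> where "\<alpha> = (if a = 0 then 0 else - \<beta> / of_real a)"
    define v' where "v' = v(x := \<alpha>)"
    have \<beta>v': "(\<Sum>j\<in>I. A x j * v' j) = \<beta>" "(\<Sum>i\<in>I. cnj (v' i) * A i x) = cnj \<beta>"
      unfolding \<beta>'[symmetric] unfolding \<beta>_def
      by (intro sum.cong refl; use insert in \<open>auto simp: v'_def\<close>)+
    have "ip I v' (app I A v') = ip I v (app I A v)"
      by (rule ip_app_cong) (use insert in \<open>auto simp: v'_def\<close>)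
    hence 1: "ip ?I v' (app ?I A v') =
      cnj \<alpha> * A x x * \<alpha> + cnj \<alpha> * \<beta> + cnj \<beta> * \<alpha> + ip I v (app I A v)"
      using ip_app_insert[OF insert(1,2), of v' A] \<beta>v' by (simp add: v'_def)
    define \<gamma> where "\<gamma> = (\<Sum>j\<in>I. cnj (b j) * v j)"
    have "ip I v (app I B v) = (\<Sum>i\<in>I. cnj (v i) * ((\<Sum>j\<in>I. A i j * v j) - b i * \<gamma>))"
      unfolding ip_def app_def B_def \<gamma>_def
      by (simp add: algebra_simps sum_subtractf sum_distrib_left)
    also have "\<dots> = ip I v (app I A v) - (\<Sum>i\<in>I. cnj (v i) * b i) * \<gamma>"
      unfolding ip_def app_def by (simp add: algebra_simps sum_subtractf sum_distrib_left)
    also have "(\<Sum>i\<in>I. cnj (v i) * b i) = cnj \<gamma>" unfolding \<gamma>_def by (simp add: mult.commute)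
    finally have 2: "ip I v (app I B v) = ip I v (app I A v) - cnj \<gamma> * \<gamma>" .
    have 3: "cnj \<alpha> * A x x * \<alpha> + cnj \<alpha> * \<beta> + cnj \<beta> * \<alpha> = - (cnj \<gamma> * \<gamma>)"
    proof (cases "a = 0")
      case True
      thus ?thesis by (simp add: \<alpha>_def \<gamma>_def b_def)
    next
      case False
      have "s \<noteq> 0" using False a by (simp add: s_def)
      have "\<gamma> = \<beta> / s"
        unfolding \<gamma>_def \<beta>_def sum_divide_distrib
      proof (intro sum.cong refl)
        fix j assume "j \<in> I"
        thus "cnj (b j) * v j = A x j * v j / s" using herm[of x j] False s by (simp add: b_def)
      qed
      hence "cnj \<gamma> * \<gamma> = cnj \<beta> * \<beta> / of_real a" using s a by simp
      moreover have "cnj \<alpha> * A x x * \<alpha> + cnj \<alpha> * \<beta> + cnj \<beta> * \<alpha> = - (cnj \<beta> * \<beta> / of_real a)"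
        using False by (simp add: \<alpha>_def a field_simps)
      ultimately show ?thesis by simp
    qed
    have "ip I v (app I B v) = ip ?I v' (app ?I A v')"
      unfolding 1 2 3 by simp
    thus "Im (ip I v (app I B v)) = 0 \<and> 0 \<le> Re (ip I v (app I B v))"
      using psd unfolding psd_on_def by simp
  qed
  from insert.IH[OF this] obtain c where
    c: "\<And>i j. i \<in> I \<Longrightarrow> j \<in> I \<Longrightarrow> B i j = (\<Sum>k\<in>I. c k i * cnj (c k j))" by blast
  \<comment> \<open>The new vector b gets the label x; the old vectors are extended by 0 at x and
    leave the row and column of x to b.\<close>
  define c' where "c' k i = (if k = x then b i else if i = x then 0 else c k i)" for k i
  have c'I: "(\<Sum>k\<in>I. c' k i * cnj (c' k j)) =
    (if i = x \<or> j = x then 0 else (\<Sum>k\<in>I. c k i * cnj (c k j)))" for i j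
    by (cases "i = x \<or> j = x") (use insert(2) in \<open>auto simp: c'_def intro!: sum.cong sum.neutral\<close>)
  have "A i j = (\<Sum>k\<in>?I. c' k i * cnj (c' k j))" if ij: "i \<in> ?I" "j \<in> ?I" for i j
  proof -
    have "(\<Sum>k\<in>?I. c' k i * cnj (c' k j)) = b i * cnj (b j) + (\<Sum>k\<in>I. c' k i * cnj (c' k j))"
      using insert(1,2) by (simp add: c'_def)
    moreover have "b x * cnj (b j) = A x j" using bx[OF ij(2)] herm[of x j] ij
      by (metis complex_cnj_cnj complex_cnj_mult insertI1 mult.commute)
    ultimately show ?thesis
      using c[of i j] bx[OF ij(1)] ij c'I[of i j] by (auto simp: B_def algebra_simps)
  qed
  thus ?case by blast
qed simp

section \<open>Traces of products of two and three kernels, and the Frobenius norm\<close>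

definition tr2 where "tr2 D A B = (\<Sum>a\<in>D. \<Sum>b\<in>D. A a b * B b a :: complex)"

definition tr3 where "tr3 D A B C = (\<Sum>a\<in>D. \<Sum>b\<in>D. \<Sum>e\<in>D. A a b * B b e * C e a :: complex)"

definition fro2 where "fro2 D A = (\<Sum>a\<in>D. \<Sum>b\<in>D. (cmod (A a b))\<^sup>2)"

lemma fro2_nonneg: "0 \<le> fro2 D A"
  unfolding fro2_def by (simp add: sum_nonneg)

lemma cmod_tr2_le: "cmod (tr2 D A B) \<le> sqrt (fro2 D A) * sqrt (fro2 D B)"
proof -
  have "cmod (\<Sum>p\<in>D\<times>D. A (fst p) (snd p) * B (snd p) (fst p))
    \<le> sqrt (\<Sum>p\<in>D\<times>D. (cmod (A (fst p) (snd p)))\<^sup>2) * sqrt (\<Sum>p\<in>D\<times>D. (cmod (B (snd p) (fst p)))\<^sup>2)"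
    by (rule cmod_sum_mult_le)
  moreover have "(\<Sum>p\<in>D\<times>D. (cmod (B (snd p) (fst p)))\<^sup>2) = fro2 D B"
    unfolding fro2_def sum.cartesian_product' by (subst sum.swap) simp
  ultimately show ?thesis
    unfolding tr2_def fro2_def sum.cartesian_product' by simp
qed

lemma tr3_eq_tr2: "tr3 D A B C = tr2 D A (\<lambda>b a. \<Sum>e\<in>D. B b e * C e a)"
  unfolding tr2_def tr3_def by (simp add: sum_distrib_left mult.assoc)

lemma fro2_mult_le: "fro2 D (\<lambda>a b. \<Sum>e\<in>D. A a e * B e b) \<le> fro2 D A * fro2 D B"
proof -
  have *: "(cmod (\<Sum>e\<in>D. A a e * B e b))\<^sup>2 \<le> (\<Sum>e\<in>D. (cmod (A a e))\<^sup>2) * (\<Sum>e\<in>D. (cmod (B e b))\<^sup>2)" for a b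
  proof -
    have "(cmod (\<Sum>e\<in>D. A a e * B e b))\<^sup>2
      \<le> (sqrt (\<Sum>e\<in>D. (cmod (A a e))\<^sup>2) * sqrt (\<Sum>e\<in>D. (cmod (B e b))\<^sup>2))\<^sup>2"
      by (intro power_mono cmod_sum_mult_le) auto
    thus ?thesis by (simp add: power_mult_distrib sum_nonneg)
  qed
  have "fro2 D (\<lambda>a b. \<Sum>e\<in>D. A a e * B e b) \<le>
    (\<Sum>a\<in>D. \<Sum>b\<in>D. (\<Sum>e\<in>D. (cmod (A a e))\<^sup>2) * (\<Sum>e\<in>D. (cmod (B e b))\<^sup>2))"
    unfolding fro2_def by (intro sum_mono *)
  also have "\<dots> = fro2 D A * (\<Sum>b\<in>D. \<Sum>e\<in>D. (cmod (B e b))\<^sup>2)"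
    unfolding fro2_def by (simp add: sum_product)
  also have "(\<Sum>b\<in>D. \<Sum>e\<in>D. (cmod (B e b))\<^sup>2) = fro2 D B"
    unfolding fro2_def by (rule sum.swap)
  finally show ?thesis .
qed

lemma cmod_tr3_le: "cmod (tr3 D A B C) \<le> sqrt (fro2 D A) * (sqrt (fro2 D B) * sqrt (fro2 D C))"
proof -
  have "cmod (tr3 D A B C) \<le> sqrt (fro2 D A) * sqrt (fro2 D (\<lambda>b a. \<Sum>e\<in>D. B b e * C e a))"
    unfolding tr3_eq_tr2 by (rule cmod_tr2_le)
  also have "\<dots> \<le> sqrt (fro2 D A) * sqrt (fro2 D B * fro2 D C)"
    by (intro mult_left_mono real_sqrt_le_mono fro2_mult_le) (simp add: fro2_nonneg)
  finally show ?thesis by (simp add: real_sqrt_mult)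
qed

definition state_on :: "'i set \<Rightarrow> ('i \<Rightarrow> 'i \<Rightarrow> complex) \<Rightarrow> bool" where
  "state_on D \<rho> \<longleftrightarrow> psd_on D \<rho> \<and> (\<Sum>a\<in>D. \<rho> a a) = 1"

text \<open>Cauchy-Schwarz on the Cholesky columns gives |\<rho>_ij|^2 \<le> \<rho>_ii \<rho>_jj,
  and the right-hand side sums to the squared trace.\<close>

lemma fro2_state_le:
  assumes "finite D" "state_on D \<rho>"
  shows "fro2 D \<rho> \<le> 1"
proof -
  from assms psd_on_factorization[of D \<rho>] obtain c where
    c: "\<And>i j. i \<in> D \<Longrightarrow> j \<in> D \<Longrightarrow> \<rho> i j = (\<Sum>k\<in>D. c k i * cnj (c k j))"
    unfolding state_on_def by blast
  define n where "n i = (\<Sum>k\<in>D. (cmod (c k i))\<^sup>2)" for i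
  have "\<rho> i i = of_real (n i)" if "i \<in> D" for i
    using c[OF that that] unfolding n_def by (simp add: complex_norm_square flip: of_real_power)
  hence "complex_of_real (\<Sum>i\<in>D. n i) = 1" using assms unfolding state_on_def by simp
  hence n1: "(\<Sum>i\<in>D. n i) = 1" by (metis of_real_1 of_real_eq_iff)
  have "(cmod (\<rho> i j))\<^sup>2 \<le> n i * n j" if "i \<in> D" "j \<in> D" for i j
  proof -
    have "(cmod (\<rho> i j))\<^sup>2 \<le> (sqrt (n i) * sqrt (n j))\<^sup>2"
      using cmod_sum_mult_le[of "\<lambda>k. c k i" "\<lambda>k. cnj (c k j)" D] c[OF that]
      by (intro power_mono) (auto simp: n_def)
    thus ?thesis by (simp add: power_mult_distrib n_def sum_nonneg)
  qed
  hence "fro2 D \<rho> \<le> (\<Sum>i\<in>D. \<Sum>j\<in>D. n i * n j)"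
    unfolding fro2_def by (intro sum_mono)
  also have "\<dots> = 1" by (simp add: n1 flip: sum_product)
  finally show ?thesis .
qed

lemma tr2_hermitian_real:
  assumes "hermitian_on D A" "hermitian_on D B"
  shows "Im (tr2 D A B) = 0"
proof -
  have "cnj (tr2 D A B) = (\<Sum>a\<in>D. \<Sum>b\<in>D. A b a * B a b)"
    unfolding tr2_def cnj_sum complex_cnj_mult
  proof (intro sum.cong refl)
    fix a b assume "a \<in> D" "b \<in> D"
    hence "A b a = cnj (A a b)" "B a b = cnj (B b a)"
      using assms unfolding hermitian_on_def by blast+
    thus "cnj (A a b) * cnj (B b a) = A b a * B a b" by simp
  qed
  also have "\<dots> = tr2 D A B" unfolding tr2_def by (rule sum.swap)
  finally show ?thesis by (simp add: complex_eq_iff)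
qed

lemma tr2_self:
  assumes "hermitian_on D A"
  shows "tr2 D A A = of_real (fro2 D A)"
  unfolding tr2_def fro2_def of_real_sum
proof (intro sum.cong refl)
  fix a b assume "a \<in> D" "b \<in> D"
  hence "A b a = cnj (A a b)" using assms unfolding hermitian_on_def by blast
  thus "A a b * A b a = complex_of_real ((cmod (A a b))\<^sup>2)"
    by (simp add: complex_norm_square flip: of_real_power)
qed

section \<open>Expectations of permutations in product states\<close>

lemma sum_PiE_insert:
  assumes "x \<notin> S"
  shows "(\<Sum>g\<in>PiE (insert x S) D. F g) = (\<Sum>y\<in>D x. \<Sum>g\<in>PiE S D. F (g(x := y)))"
  unfolding PiE_insert_eq sum.reindex[OF inj_combinator[OF assms]]
  by (simp add: sum.cartesian_product' comp_def)

lemma sum_PiE_Un: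
  assumes "A \<inter> B = {}"
  shows "(\<Sum>g\<in>PiE (A \<union> B) D. F g) =
    (\<Sum>g\<in>PiE A D. \<Sum>h\<in>PiE B D. F (\<lambda>x. if x \<in> A then g x else h x))"
  unfolding sum.cartesian_product
  by (rule sum.reindex_bij_witness[of _ "\<lambda>(g, h) x. if x \<in> A then g x else h x"
        "\<lambda>g. (restrict g A, restrict g B)"])
    (use assms in \<open>auto simp: PiE_def Pi_def extensional_def restrict_def fun_eq_iff
      intro!: arg_cong[where f = F]\<close>)

text \<open>\<open>perm_val D \<rho> A \<pi>\<close> is the trace of the product state \<open>\<rho>\<close> on the factors \<open>A\<close> against the
  operator permuting these factors by \<open>\<pi>\<close>.\<close>

definition perm_val :: "'b set \<Rightarrow> ('a \<Rightarrow> 'b \<Rightarrow> 'b \<Rightarrow> complex) \<Rightarrow> 'a set \<Rightarrow> ('a \<Rightarrow> 'a) \<Rightarrow> complex" where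
  "perm_val D \<rho> A \<pi> = (\<Sum>g\<in>PiE A (\<lambda>_. D). \<Prod>r\<in>A. \<rho> r (g r) (g (\<pi> r)))"

text \<open>A basis function on the union is a pair of basis functions, and since the permutation
  preserves both blocks no factor of the product mixes them. Values can thus be computed cycle by
  cycle.\<close>

lemma perm_val_Un:
  assumes "finite A" "finite B" "A \<inter> B = {}" "\<pi> ` A \<subseteq> A" "\<pi> ` B \<subseteq> B"
  shows "perm_val D \<rho> (A \<union> B) \<pi> = perm_val D \<rho> A \<pi> * perm_val D \<rho> B \<pi>"
proof -
  have "(\<Prod>r\<in>A \<union> B. \<rho> r (if r \<in> A then g r else h r) (if \<pi> r \<in> A then g (\<pi> r) else h (\<pi> r)))
      = (\<Prod>r\<in>A. \<rho> r (g r) (g (\<pi> r))) * (\<Prod>r\<in>B. \<rho> r (h r) (h (\<pi> r)))" for g h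
  proof -
    have "r \<notin> A \<and> \<pi> r \<notin> A" if "r \<in> B" for r using assms that by auto
    moreover have "\<pi> r \<in> A" if "r \<in> A" for r using assms that by auto
    ultimately show ?thesis
      by (subst prod.union_disjoint[OF assms(1-3)])
        (intro arg_cong2[where f = "(*)"] prod.cong; auto)
  qed
  thus ?thesis
    unfolding perm_val_def sum_PiE_Un[OF assms(3)] by (simp add: sum_product)
qed

lemma perm_val_fixed:
  assumes "finite A" "finite D" "\<And>r. r \<in> A \<Longrightarrow> \<pi> r = r" "\<And>r. r \<in> A \<Longrightarrow> (\<Sum>a\<in>D. \<rho> r a a) = 1"
  shows "perm_val D \<rho> A \<pi> = 1"
proof -
  have "perm_val D \<rho> A \<pi> = (\<Sum>g\<in>PiE A (\<lambda>_. D). \<Prod>r\<in>A. \<rho> r (g r) (g r))"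
    unfolding perm_val_def by (intro sum.cong prod.cong) (auto simp: assms)
  also have "\<dots> = (\<Prod>r\<in>A. \<Sum>a\<in>D. \<rho> r a a)"
    using assms by (intro prod_sum_PiE[symmetric]) auto
  finally show ?thesis using assms by simp
qed

lemma perm_val_2:
  assumes "s \<noteq> t" "\<pi> s = t" "\<pi> t = s"
  shows "perm_val D \<rho> {s, t} \<pi> = tr2 D (\<rho> s) (\<rho> t)"
  unfolding perm_val_def tr2_def using assms
  by (simp add: sum_PiE_insert)

lemma perm_val_3:
  assumes "s \<noteq> t" "s \<noteq> u" "t \<noteq> u" "\<pi> s = t" "\<pi> t = u" "\<pi> u = s"
  shows "perm_val D \<rho> {s, t, u} \<pi> = tr3 D (\<rho> s) (\<rho> t) (\<rho> u)"
  unfolding perm_val_def tr3_def using assms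
  by (simp add: sum_PiE_insert mult.assoc)

abbreviation "swp \<equiv> Transposition.transpose"

context
  fixes D :: "'b set" and \<rho> :: "'a \<Rightarrow> 'b \<Rightarrow> 'b \<Rightarrow> complex" and S :: "'a set"
  assumes fin: "finite D" "finite S"
    and tr1: "\<And>r. r \<in> S \<Longrightarrow> (\<Sum>a\<in>D. \<rho> r a a) = 1"
begin

text \<open>Each fixed point contributes the trace of its state, which is 1, so only the moved
  factors matter.\<close>

lemma perm_val_support:
  assumes "A \<subseteq> S" "\<pi> ` A \<subseteq> A" "\<And>r. r \<in> S - A \<Longrightarrow> \<pi> r = r"
  shows "perm_val D \<rho> S \<pi> = perm_val D \<rho> A \<pi>"
proof -
  have "finite A" using assms(1) fin(2) finite_subset by blast
  moreover have "S = A \<union> (S - A)" using assms(1) by auto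
  moreover have "perm_val D \<rho> (S - A) \<pi> = 1"
    by (rule perm_val_fixed) (use assms fin tr1 in auto)
  moreover have "\<pi> ` (S - A) \<subseteq> S - A" using assms(3) by force
  ultimately show ?thesis
    using perm_val_Un[of A "S - A" \<pi> D \<rho>] assms fin by auto
qed

lemma perm_val_swp:
  assumes "s \<in> S" "t \<in> S" "s \<noteq> t"
  shows "perm_val D \<rho> S (swp s t) = tr2 D (\<rho> s) (\<rho> t)"
proof -
  have "perm_val D \<rho> S (swp s t) = perm_val D \<rho> {s, t} (swp s t)"
    by (rule perm_val_support) (use assms in \<open>auto simp: transpose_def\<close>)
  also have "\<dots> = tr2 D (\<rho> s) (\<rho> t)" by (rule perm_val_2) (use assms in auto)
  finally show ?thesis .
qed

lemma perm_val_swp_swp_same: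
  shows "perm_val D \<rho> S (swp s t \<circ> swp s t) = 1"
  by (rule perm_val_fixed) (use fin tr1 in auto)

text \<open>The composition is the 3-cycle c to x to y to c, which determines the order of the
  states in the trace.\<close>

lemma perm_val_swp_swp_share:
  assumes "c \<in> S" "x \<in> S" "y \<in> S" "c \<noteq> x" "c \<noteq> y" "x \<noteq> y"
  shows "perm_val D \<rho> S (swp c y \<circ> swp c x) = tr3 D (\<rho> c) (\<rho> x) (\<rho> y)"
proof -
  have "perm_val D \<rho> S (swp c y \<circ> swp c x) = perm_val D \<rho> {c, x, y} (swp c y \<circ> swp c x)"
    by (rule perm_val_support) (use assms in \<open>auto simp: transpose_def\<close>)
  also have "\<dots> = tr3 D (\<rho> c) (\<rho> x) (\<rho> y)"
    by (rule perm_val_3) (use assms in \<open>auto simp: transpose_def\<close>)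
  finally show ?thesis .
qed

text \<open>This is where the product form of the state enters the variance: swaps without a common
  factor are uncorrelated.\<close>

lemma perm_val_swp_swp_disjoint:
  assumes "s \<in> S" "t \<in> S" "u \<in> S" "v \<in> S" "s \<noteq> t" "u \<noteq> v" "{s, t} \<inter> {u, v} = {}"
  shows "perm_val D \<rho> S (swp u v \<circ> swp s t) = tr2 D (\<rho> s) (\<rho> t) * tr2 D (\<rho> u) (\<rho> v)"
proof -
  let ?\<pi> = "swp u v \<circ> swp s t"
  have "perm_val D \<rho> S ?\<pi> = perm_val D \<rho> ({s, t} \<union> {u, v}) ?\<pi>"
    by (rule perm_val_support) (use assms in \<open>auto simp: transpose_def\<close>)
  also have "\<dots> = perm_val D \<rho> {s, t} ?\<pi> * perm_val D \<rho> {u, v} ?\<pi>"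
    by (rule perm_val_Un) (use assms in \<open>auto simp: transpose_def\<close>)
  also have "perm_val D \<rho> {s, t} ?\<pi> = tr2 D (\<rho> s) (\<rho> t)"
    by (rule perm_val_2) (use assms in \<open>auto simp: transpose_def\<close>)
  also have "perm_val D \<rho> {u, v} ?\<pi> = tr2 D (\<rho> u) (\<rho> v)"
    by (rule perm_val_2) (use assms in \<open>auto simp: transpose_def\<close>)
  finally show ?thesis .
qed

end

section \<open>The matrix definitions\<close>

lemma mtrace_mult:
  assumes "A \<in> carrier_mat n m" "B \<in> carrier_mat m n"
  shows "mtrace (A * B) = (\<Sum>i<n. \<Sum>j<m. A $$ (i, j) * B $$ (j, i))"
  using assms unfolding mtrace_def
  by (simp add: scalar_prod_def lessThan_atLeast0)

lemma mtrace_comm: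
  assumes "A \<in> carrier_mat n m" "B \<in> carrier_mat m n"
  shows "mtrace (A * B) = mtrace (B * A)"
  unfolding mtrace_mult[OF assms] mtrace_mult[OF assms(2,1)]
  by (subst sum.swap) (simp add: mult.commute)

text \<open>The Schur form is similar to A and carries the eigenvalues on its diagonal; cyclicity of
  the trace does the rest. It ties \<open>trace_norm\<close>, defined by roots of a characteristic
  polynomial, to matrix entries.\<close>

lemma mtrace_eq_sum_list_eigenvalues:
  assumes A: "A \<in> carrier_mat n n" and cp: "char_poly A = (\<Prod>a\<leftarrow>es. [:- a, 1:])"
  shows "mtrace A = sum_list es"
proof -
  obtain B P Q where "schur_decomposition A es = (B, P, Q)" by (cases "schur_decomposition A es") auto
  from schur_decomposition[OF A cp this] have sim: "similar_mat_wit A B P Q" and diag: "diag_mat B = es"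
    by auto
  note S = similar_mat_witD2[OF A sim]
  have "mtrace A = mtrace (P * (B * Q))" using S by (simp add: assoc_mult_mat[of _ n n _ n _ n])
  also have "\<dots> = mtrace (B * Q * P)" using S by (intro mtrace_comm) auto
  also have "\<dots> = mtrace B" using S by (simp add: assoc_mult_mat[of _ n n _ n _ n])
  also have "\<dots> = sum_list (diag_mat B)"
    unfolding mtrace_def diag_mat_def by (simp add: sum_list_sum_nth lessThan_atLeast0)
  finally show ?thesis using diag by simp
qed

lemma proots_linear_factors: "proots (\<Prod>a\<leftarrow>es. [:- a, 1:]) = mset (es :: complex list)"
proof (induction es)
  case (Cons a es)
  have "(\<Prod>a\<leftarrow>es. [:- a, 1:]) \<noteq> 0" by (auto simp: prod_list_zero_iff)
  hence "proots ([:- a, 1:] * (\<Prod>a\<leftarrow>es. [:- a, 1:])) = proots [:- a, 1:] + proots (\<Prod>a\<leftarrow>es. [:- a, 1:])"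
    by (intro proots_mult) auto
  thus ?case using Cons by simp
qed simp

lemma mat_adjoint_mult_index:
  assumes "A \<in> carrier_mat n n" "i < n" "j < n"
  shows "(mat_adjoint A * A) $$ (i, j) = (\<Sum>k<n. cnj (A $$ (k, i)) * A $$ (k, j))"
  using assms unfolding mat_adjoint_def mat_of_rows_def
  by (simp add: scalar_prod_def lessThan_atLeast0)

lemma mat_adjoint_carrier: "A \<in> carrier_mat n n \<Longrightarrow> mat_adjoint A \<in> carrier_mat n n"
  unfolding mat_adjoint_def mat_of_rows_def by auto

lemma mult_mat_vec_index:
  assumes "A \<in> carrier_mat n n" "v \<in> carrier_vec n" "i < n"
  shows "(A *\<^sub>v v) $ i = (\<Sum>j<n. A $$ (i, j) * v $ j)"
  using assms by (simp add: scalar_prod_def lessThan_atLeast0)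

text \<open>An eigenvector v satisfies |A v|^2 = e |v|^2. The real part suffices because
  \<open>trace_norm\<close> takes square roots of real parts.\<close>

lemma eigenvalue_adjoint_mult:
  assumes A: "A \<in> carrier_mat n n" and e: "eigenvalue (mat_adjoint A * A) e"
  shows "0 \<le> Re e"
proof -
  let ?I = "{..<n}" and ?B = "mat_adjoint A * A"
  have B: "?B \<in> carrier_mat n n" using mat_adjoint_carrier[OF A] A by simp
  obtain v where v: "v \<in> carrier_vec n" "v \<noteq> 0\<^sub>v n" "?B *\<^sub>v v = e \<cdot>\<^sub>v v"
    using e B unfolding eigenvalue_def eigenvector_def by auto
  define w where "w i = v $ i" for i
  define a where "a i j = A $$ (i, j)" for i j
  have Bw: "e * w i = (\<Sum>j<n. (\<Sum>k<n. cnj (a k i) * a k j) * w j)" if "i < n" for i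
  proof -
    have "e * w i = (?B *\<^sub>v v) $ i" using v that by (simp add: w_def)
    also have "\<dots> = (\<Sum>j<n. ?B $$ (i, j) * v $ j)"
      by (rule mult_mat_vec_index[OF B v(1) that])
    finally show ?thesis using that by (simp add: mat_adjoint_mult_index[OF A] w_def a_def)
  qed
  have "of_real (nrm2 ?I (app ?I a w)) = (\<Sum>k<n. \<Sum>i<n. \<Sum>j<n. cnj (w i) * (cnj (a k i) * a k j * w j))"
    unfolding ip_self[symmetric] ip_def app_def cnj_sum complex_cnj_mult sum_product
    by (intro sum.cong refl) simp
  also have "\<dots> = (\<Sum>i<n. \<Sum>k<n. \<Sum>j<n. cnj (w i) * (cnj (a k i) * a k j * w j))"
    by (rule sum.swap)
  also have "\<dots> = (\<Sum>i<n. \<Sum>j<n. \<Sum>k<n. cnj (w i) * (cnj (a k i) * a k j * w j))"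
    by (intro sum.cong refl sum.swap)
  also have "\<dots> = ip ?I w (\<lambda>i. \<Sum>j<n. (\<Sum>k<n. cnj (a k i) * a k j) * w j)"
    unfolding ip_def by (simp add: sum_distrib_left sum_distrib_right)
  also have "\<dots> = ip ?I w (\<lambda>i. e * w i)"
    by (rule ip_cong) (simp_all add: Bw)
  also have "\<dots> = e * of_real (nrm2 ?I w)" by (simp add: ip_smult_right ip_self)
  finally have "Re (of_real (nrm2 ?I (app ?I a w))) = Re (e * of_real (nrm2 ?I w))" by simp
  hence eq: "nrm2 ?I (app ?I a w) = Re e * nrm2 ?I w" by simp
  have "nrm2 ?I w \<noteq> 0"
  proof
    assume "nrm2 ?I w = 0"
    hence "w i = 0" if "i < n" for i using nrm2_eq_0[of ?I w i] that by simp
    hence "v = 0\<^sub>v n" using v by (intro eq_vecI) (auto simp: w_def)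
    thus False using v by simp
  qed
  hence "nrm2 ?I w > 0" using nrm2_nonneg[of ?I w] by simp
  thus ?thesis using eq nrm2_nonneg[of ?I "app ?I a w"] by (metis zero_le_mult_iff not_less)
qed

text \<open>Cauchy-Schwarz over the n singular values, whose squares sum to the trace of
  \<open>mat_adjoint A * A\<close>, that is, to the squared Frobenius norm.\<close>

lemma trace_norm_sq_le:
  assumes A: "A \<in> carrier_mat n n"
  shows "(trace_norm A)\<^sup>2 \<le> real n * fro2 {..<n} (\<lambda>i j. A $$ (i, j))"
proof -
  let ?B = "mat_adjoint A * A"
  have B: "?B \<in> carrier_mat n n" using mat_adjoint_carrier[OF A] A by simp
  obtain es where es: "char_poly ?B = (\<Prod>a\<leftarrow>es. [:- a, 1:])" "length es = n"
    using char_poly_factorized[OF B] by blast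
  have ge: "0 \<le> Re (es ! k)" if "k < n" for k
  proof -
    have "poly (char_poly ?B) (es ! k) = 0"
      unfolding es(1) poly_prod_list using es(2) that by (auto simp: prod_list_zero_iff)
    thus ?thesis using eigenvalue_adjoint_mult[OF A] eigenvalue_root_char_poly[OF B] by blast
  qed
  have tn: "trace_norm A = (\<Sum>k<n. sqrt (Re (es ! k)))"
    unfolding trace_norm_def es(1) proots_linear_factors
    by (simp add: sum_mset_sum_list sum_list_sum_nth es(2) lessThan_atLeast0 flip: mset_map)
  have "mtrace ?B = (\<Sum>i<n. \<Sum>k<n. cnj (A $$ (k, i)) * A $$ (k, i))"
    unfolding mtrace_def carrier_matD(1)[OF B] by (simp add: mat_adjoint_mult_index[OF A])
  also have "\<dots> = (\<Sum>k<n. \<Sum>i<n. cnj (A $$ (k, i)) * A $$ (k, i))" by (rule sum.swap)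
  also have "\<dots> = of_real (fro2 {..<n} (\<lambda>i j. A $$ (i, j)))"
    unfolding fro2_def by (simp add: complex_norm_square mult.commute flip: of_real_power)
  finally have "of_real (fro2 {..<n} (\<lambda>i j. A $$ (i, j))) = sum_list es"
    using mtrace_eq_sum_list_eigenvalues[OF B es(1)] by simp
  from arg_cong[OF this, of Re] have fr: "fro2 {..<n} (\<lambda>i j. A $$ (i, j)) = (\<Sum>k<n. Re (es ! k))"
    by (simp add: sum_list_sum_nth es(2) lessThan_atLeast0)
  have "trace_norm A = (\<Sum>k<n. \<bar>1\<bar> * \<bar>sqrt (Re (es ! k))\<bar>)"
    unfolding tn by (intro sum.cong) (auto simp: ge)
  also have "\<dots> \<le> L2_set (\<lambda>_. 1) {..<n} * L2_set (\<lambda>k. sqrt (Re (es ! k))) {..<n}"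
    by (rule L2_set_mult_ineq)
  also have "\<dots> = sqrt (real n) * sqrt (\<Sum>k<n. Re (es ! k))"
    by (simp add: L2_set_def ge)
  finally have "(trace_norm A)\<^sup>2 \<le> (sqrt (real n) * sqrt (\<Sum>k<n. Re (es ! k)))\<^sup>2"
    by (intro power_mono) (auto simp: tn ge intro!: sum_nonneg)
  also have "\<dots> = real n * (\<Sum>k<n. Re (es ! k))"
    by (auto simp: power_mult_distrib ge intro!: sum_nonneg)
  finally show ?thesis by (simp add: fr)
qed

text \<open>The most significant digit comes first: in \<open>kron A B\<close> the left factor reads
  the quotient of the index, so factor t owns the digit of weight \<open>d ^ (T - 1 - t)\<close>.
  The restriction to \<open>{..<T}\<close> makes the digit functions elements of the extensional
  function space over which \<open>perm_val\<close> sums.\<close>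

definition digits :: "nat \<Rightarrow> nat \<Rightarrow> nat \<Rightarrow> nat \<Rightarrow> nat" where
  "digits d T i = (\<lambda>t\<in>{..<T}. i div d ^ (T - 1 - t) mod d)"

lemma digit_mod_power:
  fixes i d :: nat
  assumes "k < l"
  shows "i mod d ^ l div d ^ k mod d = i div d ^ k mod d"
proof (cases "d = 0")
  case False
  have "d ^ l = d ^ k * d ^ (l - k)" using assms by (simp flip: power_add)
  hence "i mod d ^ l div d ^ k = i div d ^ k mod d ^ (l - k)"
    using False by (simp add: mod_mult2_eq)
  moreover have "d dvd d ^ (l - k)" using assms by (simp add: dvd_power)
  ultimately show ?thesis by (simp add: mod_mod_cancel)
qed (use assms in \<open>auto simp: power_0_left\<close>)

lemma digits_unique:
  fixes i j d :: nat
  assumes "i < d ^ T" "j < d ^ T" "\<And>k. k < T \<Longrightarrow> i div d ^ k mod d = j div d ^ k mod d"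
  shows "i = j"
  using assms
proof (induction T arbitrary: i j)
  case (Suc T)
  have "i div d = j div d"
  proof (rule Suc.IH)
    show "i div d < d ^ T" "j div d < d ^ T"
      using Suc.prems by (auto simp: less_mult_imp_div_less mult.commute)
    fix k assume "k < T"
    thus "i div d div d ^ k mod d = j div d div d ^ k mod d"
      using Suc.prems(3)[of "Suc k"] by (simp add: div_mult2_eq)
  qed
  moreover have "i mod d = j mod d" using Suc.prems(3)[of 0] by simp
  ultimately show ?case by (metis div_mult_mod_eq)
qed simp

lemma bij_betw_digits:
  assumes "d \<ge> 1"
  shows "bij_betw (digits d T) {..<d ^ T} ({..<T} \<rightarrow>\<^sub>E {..<d})"
proof -
  have inj: "inj_on (digits d T) {..<d ^ T}"
  proof
    fix i j assume ij: "i \<in> {..<d ^ T}" "j \<in> {..<d ^ T}" "digits d T i = digits d T j"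
    show "i = j"
    proof (rule digits_unique[of i d T])
      fix k assume "k < T"
      thus "i div d ^ k mod d = j div d ^ k mod d"
        using fun_cong[OF ij(3), of "T - 1 - k"] by (simp add: digits_def)
    qed (use ij in auto)
  qed
  moreover have "digits d T ` {..<d ^ T} = ({..<T} \<rightarrow>\<^sub>E {..<d})"
  proof (rule card_subset_eq)
    show "digits d T ` {..<d ^ T} \<subseteq> {..<T} \<rightarrow>\<^sub>E {..<d}"
      using assms by (auto simp: digits_def PiE_def extensional_def)
    show "card (digits d T ` {..<d ^ T}) = card ({..<T} \<rightarrow>\<^sub>E {..<d})"
      using inj by (simp add: card_image card_PiE)
  qed (auto intro: finite_PiE)
  ultimately show ?thesis by (simp add: bij_betw_def)
qed

text \<open>Generalised to all suffixes of the product, so that the induction can peel off the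
  leftmost factor. The digit weights refer to the full T and hence are the same for every
  suffix.\<close>

lemma foldr_kron:
  assumes "s \<le> T" "\<And>t. t < T \<Longrightarrow> \<rho> t \<in> carrier_mat d d"
  defines "M \<equiv> \<lambda>s. foldr (\<lambda>t M. kron (\<rho> t) M) [s..<T] (1\<^sub>m 1)"
  shows "M s \<in> carrier_mat (d ^ (T - s)) (d ^ (T - s)) \<and>
    (\<forall>i < d ^ (T - s). \<forall>j < d ^ (T - s). M s $$ (i, j) =
       (\<Prod>t\<in>{s..<T}. \<rho> t $$ (i div d ^ (T - 1 - t) mod d, j div d ^ (T - 1 - t) mod d)))"
  using assms(1)
proof (induction s rule: inc_induct)
  case base
  show ?case by (simp add: M_def)
next
  case (step s)
  let ?m = "d ^ (T - Suc s)"
  have m: "d ^ (T - s) = d * ?m" using step(2) by (simp add: Suc_diff_Suc flip: power_Suc)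
  have M: "M s = kron (\<rho> s) (M (Suc s))" using step(2) by (simp add: M_def upt_conv_Cons)
  have \<rho>: "\<rho> s \<in> carrier_mat d d" using assms(2) step(2) by simp
  from step.IH have M': "M (Suc s) \<in> carrier_mat ?m ?m"
    and IH: "\<And>i j. i < ?m \<Longrightarrow> j < ?m \<Longrightarrow> M (Suc s) $$ (i, j) =
       (\<Prod>t\<in>{Suc s..<T}. \<rho> t $$ (i div d ^ (T - 1 - t) mod d, j div d ^ (T - 1 - t) mod d))" by auto
  \<comment> \<open>The leading digit needs no reduction: the quotient is already below d.\<close>
  have top: "i div ?m = i div d ^ (T - 1 - s) mod d" if "i < d * ?m" for i
    using that by (simp add: less_mult_imp_div_less)
  have low: "i mod ?m div d ^ (T - Suc t) mod d = i div d ^ (T - Suc t) mod d"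
    if "t \<in> {Suc s..<T}" for i t
    by (rule digit_mod_power) (use that in auto)
  show ?case unfolding m
  proof (intro conjI allI impI)
    show "M s \<in> carrier_mat (d * ?m) (d * ?m)" unfolding M kron_def using \<rho> M' by auto
    fix i j assume ij: "i < d * ?m" "j < d * ?m"
    hence "?m > 0" by (metis gr0I mult_0_right not_less_zero)
    have "M s $$ (i, j) = \<rho> s $$ (i div ?m, j div ?m) * M (Suc s) $$ (i mod ?m, j mod ?m)"
      unfolding M kron_def using \<rho> M' ij by simp
    also have "M (Suc s) $$ (i mod ?m, j mod ?m) =
       (\<Prod>t\<in>{Suc s..<T}. \<rho> t $$ (i div d ^ (T - 1 - t) mod d, j div d ^ (T - 1 - t) mod d))"
      using \<open>?m > 0\<close> by (subst IH) (auto simp: low intro!: prod.cong)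
    also have "\<rho> s $$ (i div ?m, j div ?m)
      = \<rho> s $$ (i div d ^ (T - 1 - s) mod d, j div d ^ (T - 1 - s) mod d)"
      using top[OF ij(1)] top[OF ij(2)] by simp
    finally show "M s $$ (i, j) =
       (\<Prod>t\<in>{s..<T}. \<rho> t $$ (i div d ^ (T - 1 - t) mod d, j div d ^ (T - 1 - t) mod d))"
      using step(2) by (simp add: prod.atLeast_Suc_lessThan)
  qed
qed

lemma tensor_all_entries:
  assumes "\<And>t. t < T \<Longrightarrow> \<rho> t \<in> carrier_mat d d"
  shows "tensor_all T \<rho> \<in> carrier_mat (d ^ T) (d ^ T)"
    and "i < d ^ T \<Longrightarrow> j < d ^ T \<Longrightarrow>
      tensor_all T \<rho> $$ (i, j) = (\<Prod>t<T. \<rho> t $$ (digits d T i t, digits d T j t))"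
  using foldr_kron[of 0 T \<rho> d, OF _ assms]
  by (auto simp: tensor_all_def digits_def lessThan_atLeast0 intro!: prod.cong)

lemma psd_mat_iff_psd_on:
  assumes "A \<in> carrier_mat n n"
  shows "psd_mat n A \<longleftrightarrow> psd_on {..<n} (\<lambda>i j. A $$ (i, j))"
proof -
  have q: "(\<Sum>i<n. \<Sum>j<n. cnj (v i) * A $$ (i, j) * v j) = ip {..<n} v (app {..<n} (\<lambda>i j. A $$ (i, j)) v)"
    for v by (simp add: ip_def app_def sum_distrib_left mult.assoc)
  show ?thesis
  proof
    assume L: "psd_mat n A"
    show "psd_on {..<n} (\<lambda>i j. A $$ (i, j))" unfolding psd_on_def
    proof
      fix v :: "nat \<Rightarrow> complex"
      have "(\<Sum>i<n. \<Sum>j<n. cnj (vec n v $ i) * A $$ (i, j) * vec n v $ j)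
        = (\<Sum>i<n. \<Sum>j<n. cnj (v i) * A $$ (i, j) * v j)" by simp
      moreover have "vec n v \<in> carrier_vec n" by simp
      ultimately show "Im (ip {..<n} v (app {..<n} (\<lambda>i j. A $$ (i, j)) v)) = 0 \<and>
        0 \<le> Re (ip {..<n} v (app {..<n} (\<lambda>i j. A $$ (i, j)) v))"
        using L q unfolding psd_mat_def Let_def by metis
    qed
  next
    assume "psd_on {..<n} (\<lambda>i j. A $$ (i, j))"
    thus "psd_mat n A" using assms unfolding psd_mat_def psd_on_def Let_def q by auto
  qed
qed

lemma density_mat_state_on:
  assumes "density_mat d \<rho>"
  shows "state_on {..<d} (\<lambda>i j. \<rho> $$ (i, j))" "\<rho> \<in> carrier_mat d d"
proof -
  show c: "\<rho> \<in> carrier_mat d d" using assms by (auto simp: density_mat_def psd_mat_def)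
  show "state_on {..<d} (\<lambda>i j. \<rho> $$ (i, j))"
    using assms c psd_mat_iff_psd_on[OF c] by (auto simp: density_mat_def state_on_def mtrace_def)
qed

section \<open>The resolvent test against the moments tr (X P) and tr (X^2 P) of an observable X in
  a state P\<close>

definition ex1 :: "'i set \<Rightarrow> ('i \<Rightarrow> 'i \<Rightarrow> complex) \<Rightarrow> ('i \<Rightarrow> 'i \<Rightarrow> complex) \<Rightarrow> complex" where
  "ex1 I X P = (\<Sum>i\<in>I. \<Sum>j\<in>I. X i j * P j i)"

definition ex2 :: "'i set \<Rightarrow> ('i \<Rightarrow> 'i \<Rightarrow> complex) \<Rightarrow> ('i \<Rightarrow> 'i \<Rightarrow> complex) \<Rightarrow> complex" where
  "ex2 I X P = (\<Sum>i\<in>I. \<Sum>j\<in>I. \<Sum>k\<in>I. X i k * X k j * P j i)"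

text \<open>Once P is a sum of rank-one kernels, expectations are sums of quadratic forms at the
  unnormalised vectors \<open>u \<kappa>\<close>, so an inequality for single vectors becomes one
  for P.\<close>

lemma sum_ip_app:
  assumes P: "\<And>i j. i \<in> I \<Longrightarrow> j \<in> I \<Longrightarrow> P i j = (\<Sum>\<kappa>\<in>K. u \<kappa> i * cnj (u \<kappa> j))"
  shows "(\<Sum>\<kappa>\<in>K. ip I (u \<kappa>) (app I X (u \<kappa>))) = ex1 I X P"
proof -
  have "(\<Sum>\<kappa>\<in>K. ip I (u \<kappa>) (app I X (u \<kappa>)))
    = (\<Sum>\<kappa>\<in>K. \<Sum>i\<in>I. \<Sum>j\<in>I. X i j * (u \<kappa> j * cnj (u \<kappa> i)))"
    unfolding ip_def app_def by (simp add: sum_distrib_left mult_ac)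
  also have "\<dots> = (\<Sum>i\<in>I. \<Sum>\<kappa>\<in>K. \<Sum>j\<in>I. X i j * (u \<kappa> j * cnj (u \<kappa> i)))"
    by (rule sum.swap)
  also have "\<dots> = (\<Sum>i\<in>I. \<Sum>j\<in>I. \<Sum>\<kappa>\<in>K. X i j * (u \<kappa> j * cnj (u \<kappa> i)))"
    by (intro sum.cong refl sum.swap)
  also have "\<dots> = ex1 I X P"
    unfolding ex1_def by (intro sum.cong refl) (simp add: P sum_distrib_left)
  finally show ?thesis .
qed

lemma sum_nrm2_app:
  assumes herm: "hermitian_on I X"
    and P: "\<And>i j. i \<in> I \<Longrightarrow> j \<in> I \<Longrightarrow> P i j = (\<Sum>\<kappa>\<in>K. u \<kappa> i * cnj (u \<kappa> j))"
  shows "complex_of_real (\<Sum>\<kappa>\<in>K. nrm2 I (app I X (u \<kappa>))) = ex2 I X P"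
proof -
  let ?X2 = "\<lambda>i j. \<Sum>k\<in>I. X i k * X k j"
  have "app I X (app I X v) i = app I ?X2 v i" for v i
  proof -
    have "app I X (app I X v) i = (\<Sum>k\<in>I. \<Sum>j\<in>I. X i k * X k j * v j)"
      unfolding app_def by (simp add: sum_distrib_left mult.assoc)
    also have "\<dots> = app I ?X2 v i"
      unfolding app_def sum_distrib_right by (rule sum.swap)
    finally show ?thesis .
  qed
  hence "app I X (app I X v) = app I ?X2 v" for v by blast
  hence "complex_of_real (\<Sum>\<kappa>\<in>K. nrm2 I (app I X (u \<kappa>)))
    = (\<Sum>\<kappa>\<in>K. ip I (u \<kappa>) (app I ?X2 (u \<kappa>)))"
    by (simp add: ip_app[OF herm] flip: ip_self)
  also have "\<dots> = ex1 I ?X2 P" by (rule sum_ip_app[OF P])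
  also have "\<dots> = ex2 I X P" unfolding ex1_def ex2_def by (simp add: sum_distrib_right)
  finally show ?thesis .
qed

lemma nrm2_diff_smult:
  "nrm2 I (\<lambda>i. v i - of_real \<beta> * u i) = nrm2 I v - 2 * \<beta> * Re (ip I u v) + \<beta>\<^sup>2 * nrm2 I u"
proof -
  have eq: "(cmod (v i - of_real \<beta> * u i))\<^sup>2
    = (cmod (v i))\<^sup>2 - 2 * \<beta> * Re (cnj (u i) * v i) + \<beta>\<^sup>2 * (cmod (u i))\<^sup>2" for i
    unfolding cmod_power2 by (simp add: power2_eq_square algebra_simps)
  show ?thesis
    unfolding nrm2_def ip_def Re_sum sum_distrib_left sum.distrib[symmetric] sum_subtractf[symmetric]
    by (intro sum.cong refl eq)
qed

text \<open>The effect is \<open>(I + Y\<^sup>2)\<^sup>-\<^sup>1\<close> for \<open>Y = (X - \<theta>) / \<sigma>\<close>: it accepts where \<open>X\<close> is within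
  \<open>\<sigma>\<close> of \<open>\<theta>\<close>, and the two estimates play the role of Chebyshev's inequality.\<close>

lemma test_effect_exists:
  fixes X :: "nat \<Rightarrow> nat \<Rightarrow> complex" and \<theta> \<sigma> :: real
  assumes herm: "hermitian_on {..<n} X" and \<sigma>: "\<sigma> > 0"
  shows "\<exists>M. accept_effect n M \<and> (\<forall>P (K :: 'k set) u.
    P \<in> carrier_mat n n \<longrightarrow> (\<forall>i<n. \<forall>j<n. P $$ (i, j) = (\<Sum>\<kappa>\<in>K. u \<kappa> i * cnj (u \<kappa> j))) \<longrightarrow>
    mtrace P = 1 \<longrightarrow>
    (let m1 = Re (ex1 {..<n} X (\<lambda>i j. P $$ (i, j))); m2 = Re (ex2 {..<n} X (\<lambda>i j. P $$ (i, j)))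
     in \<sigma>\<^sup>2 * (1 - accept_prob M P) \<le> m2 - 2 * \<theta> * m1 + \<theta>\<^sup>2 \<and>
       (\<theta> < m1 \<longrightarrow> (m1 - \<theta>)\<^sup>2 * accept_prob M P \<le> 2 * (m2 - m1\<^sup>2 + \<sigma>\<^sup>2))))"
proof -
  let ?I = "{..<n}"
  define Y where "Y i j = (X i j - (if i = j then of_real \<theta> else 0)) / of_real \<sigma>" for i j
  have hermY: "hermitian_on ?I Y"
    unfolding hermitian_on_def
  proof (intro ballI)
    fix i j assume "i \<in> ?I" "j \<in> ?I"
    hence "X i j = cnj (X j i)" using herm unfolding hermitian_on_def by blast
    thus "Y i j = cnj (Y j i)" by (simp add: Y_def)
  qed
  have Yapp: "app ?I Y v i = (app ?I X v i - of_real \<theta> * v i) / of_real \<sigma>" if "i \<in> ?I" for v i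
  proof -
    have "app ?I Y v i = (\<Sum>j\<in>?I. (X i j * v j - (if i = j then of_real \<theta> * v j else 0)) / of_real \<sigma>)"
      unfolding app_def Y_def by (intro sum.cong) (auto simp: algebra_simps)
    thus ?thesis using that by (simp add: app_def sum_subtractf flip: sum_divide_distrib)
  qed
  obtain R where R: "\<And>u i. i < n \<Longrightarrow> u i = app ?I R u i + app ?I Y (app ?I Y (app ?I R u)) i"
    using resolvent_exists[OF hermY] by blast
  note bounds = resolvent_bounds[OF hermY R, unfolded lessThan_iff]
  define M where "M = mat n n (\<lambda>(i, j). R i j)"
  have M: "M \<in> carrier_mat n n" by (simp add: M_def)
  have MR: "ip ?I v (app ?I (\<lambda>i j. M $$ (i, j)) v) = ip ?I v (app ?I R v)" for v
    by (rule ip_app_cong) (auto simp: M_def)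
  have MR': "ip ?I v (app ?I (\<lambda>i j. (1\<^sub>m n - M) $$ (i, j)) v) = ip ?I v (\<lambda>i. v i - app ?I R v i)" for v
  proof (rule ip_cong)
    fix i assume i: "i \<in> ?I"
    have "app ?I (\<lambda>i j. (1\<^sub>m n - M) $$ (i, j)) v i = (\<Sum>j\<in>?I. (if i = j then v j else 0) - R i j * v j)"
      unfolding app_def M_def using i by (intro sum.cong) (auto simp: algebra_simps)
    thus "app ?I (\<lambda>i j. (1\<^sub>m n - M) $$ (i, j)) v i = v i - app ?I R v i"
      using i by (simp add: sum_subtractf app_def)
  qed simp
  have "psd_mat n M"
    unfolding psd_mat_iff_psd_on[OF M] psd_on_def MR
    by (simp add: bounds(1) nrm2_nonneg)
  moreover have "1\<^sub>m n - M \<in> carrier_mat n n" by (rule minus_carrier_mat[OF M])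
  hence "psd_mat n (1\<^sub>m n - M)"
    unfolding psd_mat_iff_psd_on[OF \<open>1\<^sub>m n - M \<in> carrier_mat n n\<close>] psd_on_def MR'
    by (simp add: bounds(2) nrm2_nonneg)
  ultimately have "accept_effect n M" by (simp add: accept_effect_def)
  moreover
  {
    fix P :: "complex mat" and K :: "'k set" and u
    assume P: "P \<in> carrier_mat n n" and tr: "mtrace P = 1"
      and Pu: "\<forall>i<n. \<forall>j<n. P $$ (i, j) = (\<Sum>\<kappa>\<in>K. u \<kappa> i * cnj (u \<kappa> j))"
    let ?P = "\<lambda>i j. P $$ (i, j)"
    define m1 where "m1 = Re (ex1 ?I X ?P)"
    define m2 where "m2 = Re (ex2 ?I X ?P)"
    have Pu': "?P i j = (\<Sum>\<kappa>\<in>K. u \<kappa> i * cnj (u \<kappa> j))" if "i \<in> ?I" "j \<in> ?I" for i j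
      using Pu that by simp
    have MP: "mtrace (M * P) = ex1 ?I R ?P"
      unfolding mtrace_mult[OF M P] ex1_def by (intro sum.cong refl) (simp add: M_def)
    have sumex: "(\<Sum>\<kappa>\<in>K. ip ?I (u \<kappa>) (app ?I A (u \<kappa>))) = ex1 ?I A ?P" for A
      by (rule sum_ip_app) (rule Pu')
    have acc: "accept_prob M P = (\<Sum>\<kappa>\<in>K. Re (ip ?I (u \<kappa>) (app ?I R (u \<kappa>))))"
      by (simp add: accept_prob_def MP flip: sumex)
    have m1: "m1 = (\<Sum>\<kappa>\<in>K. Re (ip ?I (u \<kappa>) (app ?I X (u \<kappa>))))"
      by (simp add: m1_def flip: sumex)
    have "complex_of_real (\<Sum>\<kappa>\<in>K. nrm2 ?I (app ?I X (u \<kappa>))) = ex2 ?I X ?P"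
      by (rule sum_nrm2_app[OF herm]) (rule Pu')
    from arg_cong[OF this, of Re] have m2: "m2 = (\<Sum>\<kappa>\<in>K. nrm2 ?I (app ?I X (u \<kappa>)))"
      by (simp add: m2_def)
    have "mtrace P = (\<Sum>i<n. \<Sum>\<kappa>\<in>K. u \<kappa> i * cnj (u \<kappa> i))"
      using P Pu by (simp add: mtrace_def)
    also have "\<dots> = (\<Sum>\<kappa>\<in>K. \<Sum>i<n. u \<kappa> i * cnj (u \<kappa> i))" by (rule sum.swap)
    also have "\<dots> = of_real (\<Sum>\<kappa>\<in>K. nrm2 ?I (u \<kappa>))"
      unfolding nrm2_def by (simp add: complex_norm_square flip: of_real_power)
    finally have m0: "(\<Sum>\<kappa>\<in>K. nrm2 ?I (u \<kappa>)) = 1" using tr by (metis of_real_1 of_real_eq_iff)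
    \<comment> \<open>The right-hand side is the second moment of X about \<open>\<beta>\<close>. It
      is used at \<open>\<beta> = \<theta>\<close> for the acceptance bound and at
      \<open>\<beta> = m1\<close>, where it is the variance, for the rejection bound.\<close>
    have shift: "\<sigma>\<^sup>2 * (\<Sum>\<kappa>\<in>K. nrm2 ?I (\<lambda>i. (app ?I X (u \<kappa>) i - of_real \<beta> * u \<kappa> i) / of_real \<sigma>))
      = m2 - 2 * \<beta> * m1 + \<beta>\<^sup>2" for \<beta>
    proof -
      have "\<sigma>\<^sup>2 * nrm2 ?I (\<lambda>i. v i / of_real \<sigma>) = nrm2 ?I v" for v
        using \<sigma> unfolding nrm2_def by (simp add: norm_divide power_divide flip: sum_divide_distrib)
      hence "\<sigma>\<^sup>2 * (\<Sum>\<kappa>\<in>K. nrm2 ?I (\<lambda>i. (app ?I X (u \<kappa>) i - of_real \<beta> * u \<kappa> i) / of_real \<sigma>))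
        = (\<Sum>\<kappa>\<in>K. nrm2 ?I (\<lambda>i. app ?I X (u \<kappa>) i - of_real \<beta> * u \<kappa> i))"
        by (simp add: sum_distrib_left)
      also have "\<dots> = m2 - 2 * \<beta> * m1 + \<beta>\<^sup>2 * (\<Sum>\<kappa>\<in>K. nrm2 ?I (u \<kappa>))"
        unfolding m1 m2 nrm2_diff_smult by (simp add: sum.distrib sum_subtractf sum_distrib_left)
      finally show ?thesis by (simp add: m0)
    qed
    have "1 - accept_prob M P = (\<Sum>\<kappa>\<in>K. nrm2 ?I (u \<kappa>) - Re (ip ?I (u \<kappa>) (app ?I R (u \<kappa>))))"
      by (simp add: acc m0 sum_subtractf)
    also have "\<dots> \<le> (\<Sum>\<kappa>\<in>K. nrm2 ?I (app ?I Y (u \<kappa>)))"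
      by (intro sum_mono bounds(3)) auto
    also have "\<dots> = (\<Sum>\<kappa>\<in>K. nrm2 ?I (\<lambda>i. (app ?I X (u \<kappa>) i - of_real \<theta> * u \<kappa> i) / of_real \<sigma>))"
      by (intro sum.cong refl nrm2_cong Yapp)
    finally have "\<sigma>\<^sup>2 * (1 - accept_prob M P) \<le> m2 - 2 * \<theta> * m1 + \<theta>\<^sup>2"
      unfolding shift[symmetric] by (intro mult_left_mono) auto
    moreover have "(m1 - \<theta>)\<^sup>2 * accept_prob M P \<le> 2 * (m2 - m1\<^sup>2 + \<sigma>\<^sup>2)" if "\<theta> < m1"
    proof -
      \<comment> \<open>The mean of Y in the state P, so that Y - \<open>\<mu>\<close> is (X - m1) /
        \<open>\<sigma>\<close> and the threshold drops out.\<close>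
      define \<mu> where "\<mu> = (m1 - \<theta>) / \<sigma>"
      have \<mu>: "\<mu> > 0" using that \<sigma> by (simp add: \<mu>_def)
      have "\<mu>\<^sup>2 * accept_prob M P = (\<Sum>\<kappa>\<in>K. \<mu>\<^sup>2 * Re (ip ?I (u \<kappa>) (app ?I R (u \<kappa>))))"
        by (simp add: acc sum_distrib_left)
      also have "\<dots> \<le> (\<Sum>\<kappa>\<in>K. 2 * (nrm2 ?I (\<lambda>i. app ?I Y (u \<kappa>) i - of_real \<mu> * u \<kappa> i) + nrm2 ?I (u \<kappa>)))"
        by (intro sum_mono bounds(4) \<mu>) auto
      also have "\<dots> = (\<Sum>\<kappa>\<in>K. 2 * (nrm2 ?I (\<lambda>i. (app ?I X (u \<kappa>) i - of_real m1 * u \<kappa> i) / of_real \<sigma>)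
          + nrm2 ?I (u \<kappa>)))"
        using \<sigma> by (intro sum.cong arg_cong2[where f = "(+)"] arg_cong[where f = "(*) 2"] nrm2_cong refl)
          (simp add: Yapp \<mu>_def field_simps)
      also have "\<dots> = 2 * ((\<Sum>\<kappa>\<in>K. nrm2 ?I (\<lambda>i. (app ?I X (u \<kappa>) i - of_real m1 * u \<kappa> i) / of_real \<sigma>)) + 1)"
        by (simp add: m0 sum.distrib flip: sum_distrib_left)
      finally have "\<sigma>\<^sup>2 * (\<mu>\<^sup>2 * accept_prob M P) \<le>
        \<sigma>\<^sup>2 * (2 * ((\<Sum>\<kappa>\<in>K. nrm2 ?I (\<lambda>i. (app ?I X (u \<kappa>) i - of_real m1 * u \<kappa> i) / of_real \<sigma>)) + 1))"
        by (intro mult_left_mono) auto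
      also have "\<dots> = 2 * (m2 - m1\<^sup>2 + \<sigma>\<^sup>2)"
        using shift[of m1] by (simp add: algebra_simps power2_eq_square)
      also have "\<sigma>\<^sup>2 * (\<mu>\<^sup>2 * accept_prob M P) = (m1 - \<theta>)\<^sup>2 * accept_prob M P"
        using \<sigma> by (simp add: \<mu>_def power_divide)
      finally show ?thesis .
    qed
    ultimately have "\<sigma>\<^sup>2 * (1 - accept_prob M P) \<le> m2 - 2 * \<theta> * m1 + \<theta>\<^sup>2 \<and>
       (\<theta> < m1 \<longrightarrow> (m1 - \<theta>)\<^sup>2 * accept_prob M P \<le> 2 * (m2 - m1\<^sup>2 + \<sigma>\<^sup>2))" by blast
    note this[unfolded m1_def m2_def]
  }
  ultimately show ?thesis unfolding Let_def by blast
qed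

section \<open>Moments of the sum of all swaps\<close>

text \<open>Ordered pairs count each swap twice, so that the mean becomes the full double sum of
  overlaps without its diagonal.\<close>

definition pairs :: "'a set \<Rightarrow> ('a \<times> 'a) set" where
  "pairs S = (SIGMA s:S. S - {s})"

text \<open>Each summand is the matrix entry, in the product basis, of the operator exchanging the
  tensor factors s and t.\<close>

definition swap_sum :: "'a set \<Rightarrow> ('a \<Rightarrow> 'b) \<Rightarrow> ('a \<Rightarrow> 'b) \<Rightarrow> complex" where
  "swap_sum S f g = (\<Sum>(s, t)\<in>pairs S. of_bool (f = g \<circ> swp s t))"

definition product_state :: "'a set \<Rightarrow> ('a \<Rightarrow> 'b \<Rightarrow> 'b \<Rightarrow> complex) \<Rightarrow> ('a \<Rightarrow> 'b) \<Rightarrow> ('a \<Rightarrow> 'b) \<Rightarrow> complex" where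
  "product_state S \<rho> f g = (\<Prod>r\<in>S. \<rho> r (f r) (g r))"

lemma sum_pairs: "finite S \<Longrightarrow> (\<Sum>(s, t)\<in>pairs S. F s t) = (\<Sum>s\<in>S. \<Sum>t\<in>S - {s}. F s t)"
  unfolding pairs_def by (subst sum.Sigma) auto

lemma sum_pairs_flip: "(\<Sum>(s, t)\<in>pairs S. F s t) = (\<Sum>(s, t)\<in>pairs S. F t s)"
  by (rule sum.reindex_bij_witness[of _ prod.swap prod.swap]) (auto simp: pairs_def)

lemma comp_swp_PiE:
  assumes "g \<in> S \<rightarrow>\<^sub>E D" "s \<in> S" "t \<in> S"
  shows "g \<circ> swp s t \<in> S \<rightarrow>\<^sub>E D"
  using assms by (auto simp: PiE_def Pi_def extensional_def transpose_def)

lemma swap_sum_sym: "swap_sum S f g = swap_sum S g f"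
proof -
  have "(f = g \<circ> swp s t) = (g = f \<circ> swp s t)" for s t
    by (auto simp: comp_assoc)
  thus ?thesis unfolding swap_sum_def by simp
qed

lemma hermitian_swap_sum: "hermitian_on I (swap_sum S)"
  unfolding hermitian_on_def
proof (intro ballI)
  fix f g
  have "cnj (swap_sum S g f) = swap_sum S g f"
    unfolding swap_sum_def cnj_sum by (intro sum.cong) auto
  thus "swap_sum S f g = cnj (swap_sum S g f)" using swap_sum_sym[of S f g] by simp
qed

text \<open>Every swap operator is a permutation matrix: its column h has a single 1, in row
  \<open>h \<circ> swp s t\<close>.\<close>

lemma sum_swap_sum:
  assumes "finite S" "finite D" "h \<in> S \<rightarrow>\<^sub>E D"
  shows "(\<Sum>f\<in>S \<rightarrow>\<^sub>E D. swap_sum S f h * F f) = (\<Sum>(s, t)\<in>pairs S. F (h \<circ> swp s t))"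
proof -
  have fin: "finite (S \<rightarrow>\<^sub>E D)" using assms by (intro finite_PiE) auto
  have "(\<Sum>f\<in>S \<rightarrow>\<^sub>E D. swap_sum S f h * F f)
    = (\<Sum>f\<in>S \<rightarrow>\<^sub>E D. \<Sum>(s, t)\<in>pairs S. if f = h \<circ> swp s t then F f else 0)"
    unfolding swap_sum_def sum_distrib_right by (intro sum.cong refl) auto
  also have "\<dots> = (\<Sum>(s, t)\<in>pairs S. \<Sum>f\<in>S \<rightarrow>\<^sub>E D. if f = h \<circ> swp s t then F f else 0)"
    unfolding case_prod_beta by (rule sum.swap)
  also have "\<dots> = (\<Sum>(s, t)\<in>pairs S. F (h \<circ> swp s t))"
  proof (intro sum.cong refl, clarify)
    fix s t assume "(s, t) \<in> pairs S"
    hence "h \<circ> swp s t \<in> S \<rightarrow>\<^sub>E D" by (intro comp_swp_PiE assms) (auto simp: pairs_def)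
    thus "(\<Sum>f\<in>S \<rightarrow>\<^sub>E D. if f = h \<circ> swp s t then F f else 0) = F (h \<circ> swp s t)"
      using fin by (simp add: sum.delta')
  qed
  finally show ?thesis .
qed

lemma ex1_swap_sum:
  assumes "finite S" "finite D"
  shows "ex1 (S \<rightarrow>\<^sub>E D) (swap_sum S) (product_state S \<rho>) = (\<Sum>(s, t)\<in>pairs S. perm_val D \<rho> S (swp s t))"
proof -
  have "ex1 (S \<rightarrow>\<^sub>E D) (swap_sum S) (product_state S \<rho>)
    = (\<Sum>g\<in>S \<rightarrow>\<^sub>E D. \<Sum>f\<in>S \<rightarrow>\<^sub>E D. swap_sum S f g * product_state S \<rho> g f)"
    unfolding ex1_def by (rule sum.swap)
  also have "\<dots> = (\<Sum>g\<in>S \<rightarrow>\<^sub>E D. \<Sum>(s, t)\<in>pairs S. product_state S \<rho> g (g \<circ> swp s t))"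
    by (intro sum.cong refl sum_swap_sum assms)
  also have "\<dots> = (\<Sum>(s, t)\<in>pairs S. perm_val D \<rho> S (swp s t))"
    unfolding case_prod_beta perm_val_def product_state_def by (subst sum.swap) simp
  finally show ?thesis .
qed

text \<open>Two of the three sums over basis functions collapse, one for each factor X; the
  remaining one is the value of the composed permutation.\<close>

lemma ex2_swap_sum:
  assumes "finite S" "finite D"
  shows "ex2 (S \<rightarrow>\<^sub>E D) (swap_sum S) (product_state S \<rho>) =
    (\<Sum>(s, t)\<in>pairs S. \<Sum>(u, v)\<in>pairs S. perm_val D \<rho> S (swp u v \<circ> swp s t))"
proof -
  let ?O = "S \<rightarrow>\<^sub>E D" and ?x = "swap_sum S" and ?\<tau> = "product_state S \<rho>"
  have "ex2 ?O ?x ?\<tau> = (\<Sum>g\<in>?O. \<Sum>f\<in>?O. \<Sum>h\<in>?O. ?x f h * ?x h g * ?\<tau> g f)"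
    unfolding ex2_def by (rule sum.swap)
  also have "\<dots> = (\<Sum>g\<in>?O. \<Sum>h\<in>?O. \<Sum>f\<in>?O. ?x f h * ?x h g * ?\<tau> g f)"
    by (intro sum.cong refl sum.swap)
  also have "\<dots> = (\<Sum>g\<in>?O. \<Sum>h\<in>?O. ?x h g * (\<Sum>f\<in>?O. ?x f h * ?\<tau> g f))"
    by (simp add: sum_distrib_left mult_ac)
  also have "\<dots> = (\<Sum>g\<in>?O. \<Sum>h\<in>?O. ?x h g * (\<Sum>(s, t)\<in>pairs S. ?\<tau> g (h \<circ> swp s t)))"
    by (intro sum.cong arg_cong2[where f = "(*)"] refl sum_swap_sum assms)
  also have "\<dots> = (\<Sum>g\<in>?O. \<Sum>(u, v)\<in>pairs S. \<Sum>(s, t)\<in>pairs S. ?\<tau> g (g \<circ> swp u v \<circ> swp s t))"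
    by (intro sum.cong refl sum_swap_sum assms)
  also have "\<dots> = (\<Sum>(u, v)\<in>pairs S. \<Sum>g\<in>?O. \<Sum>(s, t)\<in>pairs S. ?\<tau> g (g \<circ> swp u v \<circ> swp s t))"
    unfolding case_prod_beta by (rule sum.swap)
  also have "\<dots> = (\<Sum>(u, v)\<in>pairs S. \<Sum>(s, t)\<in>pairs S. \<Sum>g\<in>?O. ?\<tau> g (g \<circ> swp u v \<circ> swp s t))"
    unfolding case_prod_beta by (intro sum.cong refl sum.swap)
  also have "\<dots> = (\<Sum>(u, v)\<in>pairs S. \<Sum>(s, t)\<in>pairs S. perm_val D \<rho> S (swp u v \<circ> swp s t))"
    by (simp add: perm_val_def product_state_def)
  also have "\<dots> = (\<Sum>(s, t)\<in>pairs S. \<Sum>(u, v)\<in>pairs S. perm_val D \<rho> S (swp u v \<circ> swp s t))"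
    unfolding case_prod_beta by (rule sum.swap)
  finally show ?thesis .
qed

section \<open>Traces under shifts by multiples of the identity\<close>

definition scal :: "complex \<Rightarrow> 'b \<Rightarrow> 'b \<Rightarrow> complex" where
  "scal \<kappa> a b = (if a = b then \<kappa> else 0)"

lemma tr2_sum_right: "tr2 D A (\<lambda>a b. \<Sum>x\<in>X. f x a b) = (\<Sum>x\<in>X. tr2 D A (f x))"
  unfolding tr2_def sum_distrib_left
  by (subst sum.swap, intro sum.cong refl, subst sum.swap) (simp add: sum.swap[of _ X])

lemma tr2_comm: "tr2 D A B = tr2 D B A"
  unfolding tr2_def by (subst sum.swap) (simp add: mult.commute)

lemma tr2_add_right: "tr2 D A (\<lambda>a b. B a b + C a b) = tr2 D A B + tr2 D A C"
  unfolding tr2_def by (simp add: algebra_simps sum.distrib)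

lemma tr3_add:
  "tr3 D A (\<lambda>a b. B a b + C a b) E = tr3 D A B E + tr3 D A C E"
  "tr3 D A E (\<lambda>a b. B a b + C a b) = tr3 D A E B + tr3 D A E C"
  unfolding tr3_def by (simp_all add: algebra_simps sum.distrib)

lemma tr2_scal:
  assumes "finite D"
  shows "tr2 D A (scal \<kappa>) = \<kappa> * (\<Sum>a\<in>D. A a a)"
proof -
  have "tr2 D A (scal \<kappa>) = (\<Sum>a\<in>D. \<Sum>b\<in>D. if b = a then A a a * \<kappa> else 0)"
    unfolding tr2_def scal_def by (intro sum.cong) auto
  thus ?thesis using assms by (simp add: sum_distrib_left mult.commute)
qed

lemma tr3_scal_mid:
  assumes "finite D"
  shows "tr3 D A (scal \<kappa>) B = \<kappa> * tr2 D A B"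
proof -
  have "tr3 D A (scal \<kappa>) B = (\<Sum>a\<in>D. \<Sum>b\<in>D. \<Sum>e\<in>D. if b = e then \<kappa> * (A a b * B b a) else 0)"
    unfolding tr3_def scal_def by (intro sum.cong) auto
  thus ?thesis using assms by (simp add: tr2_def sum_distrib_left)
qed

lemma tr3_scal_right:
  assumes "finite D"
  shows "tr3 D A B (scal \<kappa>) = \<kappa> * tr2 D A B"
proof -
  have "tr3 D A B (scal \<kappa>) = (\<Sum>a\<in>D. \<Sum>b\<in>D. \<Sum>e\<in>D. if e = a then \<kappa> * (A a b * B b a) else 0)"
    unfolding tr3_def scal_def by (intro sum.cong) auto
  thus ?thesis using assms by (simp add: tr2_def sum_distrib_left)
qed

lemma tr3_sum_sum:
  "tr3 D A (\<lambda>a b. \<Sum>x\<in>X. f x a b) (\<lambda>a b. \<Sum>x\<in>X. f x a b) = (\<Sum>x\<in>X. \<Sum>y\<in>X. tr3 D A (f x) (f y))"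
proof -
  have "(\<lambda>b a. \<Sum>e\<in>D. (\<Sum>x\<in>X. f x b e) * (\<Sum>y\<in>X. f y e a))
    = (\<lambda>b a. \<Sum>x\<in>X. \<Sum>y\<in>X. \<Sum>e\<in>D. f x b e * f y e a)"
    unfolding sum_product by (intro ext, subst sum.swap, intro sum.cong refl sum.swap)
  thus ?thesis unfolding tr3_eq_tr2 by (simp add: tr2_sum_right)
qed

text \<open>The variance of an observable \<open>A\<close> does not change when a multiple of the identity is
  subtracted from it.\<close>

lemma variance_le_fro2:
  fixes \<kappa> :: real
  assumes fin: "finite D" and tr: "(\<Sum>a\<in>D. \<rho> a a) = 1" and fro: "fro2 D \<rho> \<le> 1"
  shows "Re (tr3 D \<rho> A A) - (Re (tr2 D \<rho> A))\<^sup>2 \<le> fro2 D (\<lambda>a b. A a b - scal (of_real \<kappa>) a b)"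
proof -
  define B where "B = (\<lambda>a b. A a b - scal (of_real \<kappa>) a b)"
  have A: "A = (\<lambda>a b. B a b + scal (of_real \<kappa>) a b)" by (simp add: B_def)
  have 2: "tr2 D \<rho> A = tr2 D \<rho> B + of_real \<kappa>"
    by (subst A) (simp add: tr2_add_right tr2_scal fin tr)
  have 3: "tr3 D \<rho> A A = tr3 D \<rho> B B + 2 * of_real \<kappa> * tr2 D \<rho> B + of_real \<kappa> * of_real \<kappa>"
  proof -
    have "tr3 D \<rho> A A = tr3 D \<rho> (\<lambda>a b. B a b + scal (of_real \<kappa>) a b) (\<lambda>a b. B a b + scal (of_real \<kappa>) a b)"
      by (simp only: A[symmetric])
    thus ?thesis
      by (simp add: tr3_add tr3_scal_mid tr3_scal_right tr2_scal fin tr algebra_simps)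
  qed
  have "Re (tr3 D \<rho> A A) - (Re (tr2 D \<rho> A))\<^sup>2 = Re (tr3 D \<rho> B B) - (Re (tr2 D \<rho> B))\<^sup>2"
    unfolding 2 3 by (simp add: power2_eq_square algebra_simps)
  \<comment> \<open>The squared mean is discarded and the Frobenius norm of \<open>\<rho>\<close>,
    at most 1, is then estimated away; no factor depending on the dimension arises.\<close>
  also have "\<dots> \<le> cmod (tr3 D \<rho> B B)"
    using complex_Re_le_cmod[of "tr3 D \<rho> B B"] zero_le_power2[of "Re (tr2 D \<rho> B)"] by linarith
  also have "\<dots> \<le> sqrt (fro2 D \<rho>) * (sqrt (fro2 D B) * sqrt (fro2 D B))" by (rule cmod_tr3_le)
  also have "\<dots> = sqrt (fro2 D \<rho>) * fro2 D B" by (simp add: fro2_nonneg)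
  also have "\<dots> \<le> 1 * fro2 D B"
    using fro by (intro mult_right_mono) (auto simp: fro2_nonneg real_sqrt_le_1_iff)
  finally show ?thesis by (simp add: B_def)
qed

lemma fro2_diff_le: "fro2 D (\<lambda>a b. A a b - B a b) \<le> 2 * fro2 D A + 2 * fro2 D B"
proof -
  have "fro2 D (\<lambda>a b. A a b - B a b) = (\<Sum>a\<in>D. nrm2 D (\<lambda>b. A a b + - B a b))"
    by (simp add: fro2_def nrm2_def)
  also have "\<dots> \<le> (\<Sum>a\<in>D. 2 * nrm2 D (A a) + 2 * nrm2 D (\<lambda>b. - B a b))"
    by (intro sum_mono nrm2_add_le)
  also have "\<dots> = 2 * fro2 D A + 2 * fro2 D B"
    by (simp add: fro2_def nrm2_def sum.distrib sum_distrib_left)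
  finally show ?thesis .
qed

section \<open>Covariances of swaps, and mean and variance of their sum\<close>

definition overlap :: "'b set \<Rightarrow> ('a \<Rightarrow> 'b \<Rightarrow> 'b \<Rightarrow> complex) \<Rightarrow> 'a \<Rightarrow> 'a \<Rightarrow> real" where
  "overlap D \<rho> s t = Re (tr2 D (\<rho> s) (\<rho> t))"

text \<open>The covariance of the observables \<open>\<rho> x\<close> and \<open>\<rho> y\<close> in
  the state \<open>\<rho> c\<close>. For distinct c, x, y it is also the covariance of the swaps of
  c with x and of c with y; for x = y the two notions differ.\<close>

definition cov3 :: "'b set \<Rightarrow> ('a \<Rightarrow> 'b \<Rightarrow> 'b \<Rightarrow> complex) \<Rightarrow> 'a \<Rightarrow> 'a \<Rightarrow> 'a \<Rightarrow> real" where
  "cov3 D \<rho> c x y = Re (tr3 D (\<rho> c) (\<rho> x) (\<rho> y)) - overlap D \<rho> c x * overlap D \<rho> c y"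

definition pair_cov :: "'b set \<Rightarrow> ('a \<Rightarrow> 'b \<Rightarrow> 'b \<Rightarrow> complex) \<Rightarrow> 'a set \<Rightarrow> 'a \<Rightarrow> 'a \<Rightarrow> 'a \<Rightarrow> 'a \<Rightarrow> real" where
  "pair_cov D \<rho> S s t u v =
    Re (perm_val D \<rho> S (swp u v \<circ> swp s t)) - overlap D \<rho> s t * overlap D \<rho> u v"

definition swap_mean :: "'b set \<Rightarrow> ('a \<Rightarrow> 'b \<Rightarrow> 'b \<Rightarrow> complex) \<Rightarrow> 'a set \<Rightarrow> real" where
  "swap_mean D \<rho> S = Re (ex1 (S \<rightarrow>\<^sub>E D) (swap_sum S) (product_state S \<rho>))"

definition swap_moment2 :: "'b set \<Rightarrow> ('a \<Rightarrow> 'b \<Rightarrow> 'b \<Rightarrow> complex) \<Rightarrow> 'a set \<Rightarrow> real" where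
  "swap_moment2 D \<rho> S = Re (ex2 (S \<rightarrow>\<^sub>E D) (swap_sum S) (product_state S \<rho>))"

text \<open>For \<open>\<kappa>\<close> = T/d and density matrices this is T (\<rho>_avg - I/d),
  which has trace 0.\<close>

definition deviation :: "('a \<Rightarrow> 'b \<Rightarrow> 'b \<Rightarrow> complex) \<Rightarrow> 'a set \<Rightarrow> real \<Rightarrow> 'b \<Rightarrow> 'b \<Rightarrow> complex" where
  "deviation \<rho> S \<kappa> a b = (\<Sum>r\<in>S. \<rho> r a b) - scal (of_real \<kappa>) a b"

context
  fixes D :: "'b set" and \<rho> :: "'a \<Rightarrow> 'b \<Rightarrow> 'b \<Rightarrow> complex" and S :: "'a set"
  assumes fin: "finite D" "finite S"
    and states: "\<And>r. r \<in> S \<Longrightarrow> state_on D (\<rho> r)"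
begin

lemma trace_state: "r \<in> S \<Longrightarrow> (\<Sum>a\<in>D. \<rho> r a a) = 1"
  using states unfolding state_on_def by blast

lemma fro2_le: "r \<in> S \<Longrightarrow> fro2 D (\<rho> r) \<le> 1"
  using fro2_state_le[OF fin(1) states] .

lemma hermitian_state: "r \<in> S \<Longrightarrow> hermitian_on D (\<rho> r)"
  using psd_on_hermitian[OF _ fin(1)] states unfolding state_on_def by blast

lemma tr2_eq_overlap: "s \<in> S \<Longrightarrow> t \<in> S \<Longrightarrow> tr2 D (\<rho> s) (\<rho> t) = of_real (overlap D \<rho> s t)"
  unfolding overlap_def using tr2_hermitian_real[OF hermitian_state hermitian_state] by (simp add: complex_eq_iff)

lemma overlap_comm: "overlap D \<rho> s t = overlap D \<rho> t s"
  unfolding overlap_def by (simp add: tr2_comm)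

lemma abs_overlap_le:
  assumes "s \<in> S" "t \<in> S"
  shows "\<bar>overlap D \<rho> s t\<bar> \<le> 1"
proof -
  have "\<bar>overlap D \<rho> s t\<bar> \<le> sqrt (fro2 D (\<rho> s)) * sqrt (fro2 D (\<rho> t))"
    unfolding overlap_def using abs_Re_le_cmod cmod_tr2_le by (rule order_trans)
  also have "\<dots> \<le> 1 * 1"
    using fro2_le assms by (intro mult_mono) (auto simp: fro2_nonneg)
  finally show ?thesis by simp
qed

text \<open>A crude bound, needed only for the diagonal terms: adding 3 to them makes them at least
  1, which is what the covariance of a swap with itself can reach.\<close>

lemma cov3_ge:
  assumes "c \<in> S" "x \<in> S"
  shows "-2 \<le> cov3 D \<rho> c x x"
proof -
  have "cmod (tr3 D (\<rho> c) (\<rho> x) (\<rho> x)) \<le> sqrt (fro2 D (\<rho> c)) * (sqrt (fro2 D (\<rho> x)) * sqrt (fro2 D (\<rho> x)))"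
    by (rule cmod_tr3_le)
  also have "\<dots> \<le> 1 * (1 * 1)"
    using fro2_le assms by (intro mult_mono) (auto simp: fro2_nonneg)
  finally have "cmod (tr3 D (\<rho> c) (\<rho> x) (\<rho> x)) \<le> 1" by simp
  hence "-1 \<le> Re (tr3 D (\<rho> c) (\<rho> x) (\<rho> x))"
    using abs_Re_le_cmod[of "tr3 D (\<rho> c) (\<rho> x) (\<rho> x)"] by linarith
  moreover have "overlap D \<rho> c x * overlap D \<rho> c x \<le> 1"
    using abs_overlap_le[OF assms] by (metis abs_square_le_1 power2_eq_square)
  ultimately show ?thesis unfolding cov3_def by linarith
qed

text \<open>Each coincidence of indices is charged one term H. If the swaps share one factor,
  exactly one term is present and equals the covariance; if they coincide, two terms are present,
  each at least 1. Admitting x = y in H at the cost of the correction 3 is what later completes the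
  double sum to a variance.\<close>

lemma pair_cov_le:
  assumes "s \<in> S" "t \<in> S" "s \<noteq> t" "u \<in> S" "v \<in> S" "u \<noteq> v"
  defines "H \<equiv> \<lambda>c x y. cov3 D \<rho> c x y + (if x = y then 3 else 0)"
  shows "pair_cov D \<rho> S s t u v \<le> (if s = u then H s t v else 0) + (if s = v then H s t u else 0)
    + (if t = u then H t s v else 0) + (if t = v then H t s u else 0)"
proof -
  note perm = fin trace_state
  have H1: "H c x x \<ge> 1" if "c \<in> S" "x \<in> S" for c x
    using cov3_ge[OF that] by (simp add: H_def)
  have same: "pair_cov D \<rho> S s t s t \<le> 1"
    using perm_val_swp_swp_same[of D S \<rho> s t, OF perm] by (simp add: pair_cov_def)
  have share: "pair_cov D \<rho> S c x c y = H c x y" if "c \<in> S" "x \<in> S" "y \<in> S" "c \<noteq> x" "c \<noteq> y" "x \<noteq> y" for c x y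
    using perm_val_swp_swp_share[of D S \<rho> c x y, OF perm] that by (simp add: pair_cov_def H_def cov3_def)
  have flip: "pair_cov D \<rho> S a b c e = pair_cov D \<rho> S b a c e" "pair_cov D \<rho> S a b c e = pair_cov D \<rho> S a b e c" for a b c e
    unfolding pair_cov_def by (simp_all add: transpose_commute overlap_comm)
  consider "s = u" "t = v" | "s = v" "t = u" | "s = u" "t \<noteq> v" | "s = v" "t \<noteq> u"
    | "t = u" "s \<noteq> v" | "t = v" "s \<noteq> u" | "{s, t} \<inter> {u, v} = {}" by blast
  thus ?thesis
  proof cases
    case 1
    thus ?thesis using same H1[of s t] H1[of t s] assms by simp
  next
    case 2
    thus ?thesis using same H1[of s t] H1[of t s] assms flip(2)[of s t s t] by simp
  next
    case 3
    thus ?thesis using share[of s t v] assms by simp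
  next
    case 4
    thus ?thesis using share[of s t u] assms flip(2)[of s t u v] by simp
  next
    case 5
    thus ?thesis using share[of t s v] assms flip(1)[of s t u v] by simp
  next
    case 6
    thus ?thesis using share[of t s u] assms flip(1)[of s t u v] flip(2)[of t s u v] by simp
  next
    case 7
    hence "pair_cov D \<rho> S s t u v = 0"
      using perm_val_swp_swp_disjoint[of D S \<rho> s t u v, OF perm] assms
      by (simp add: pair_cov_def tr2_eq_overlap)
    moreover have "s \<noteq> u" "s \<noteq> v" "t \<noteq> u" "t \<noteq> v" using 7 by auto
    ultimately show ?thesis by simp
  qed
qed

lemma m1_eq: "swap_mean D \<rho> S = (\<Sum>(s, t)\<in>pairs S. overlap D \<rho> s t)"
proof -
  have "swap_mean D \<rho> S = (\<Sum>(s, t)\<in>pairs S. Re (perm_val D \<rho> S (swp s t)))"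
    unfolding swap_mean_def ex1_swap_sum[OF fin(2,1)] by (simp add: case_prod_beta)
  also have "\<dots> = (\<Sum>(s, t)\<in>pairs S. overlap D \<rho> s t)"
  proof (intro sum.cong refl, clarify)
    fix s t assume "(s, t) \<in> pairs S"
    hence "s \<in> S" "t \<in> S" "s \<noteq> t" by (auto simp: pairs_def)
    hence "perm_val D \<rho> S (swp s t) = tr2 D (\<rho> s) (\<rho> t)"
      by (intro perm_val_swp fin trace_state)
    thus "Re (perm_val D \<rho> S (swp s t)) = overlap D \<rho> s t" by (simp add: overlap_def)
  qed
  finally show ?thesis .
qed

lemma variance_eq: "swap_moment2 D \<rho> S - (swap_mean D \<rho> S)\<^sup>2 = (\<Sum>(s, t)\<in>pairs S. \<Sum>(u, v)\<in>pairs S. pair_cov D \<rho> S s t u v)"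
  unfolding m1_eq swap_moment2_def ex2_swap_sum[OF fin(2,1)] pair_cov_def
  by (simp add: case_prod_beta sum_subtractf power2_eq_square sum_product)

lemma sum_pairs_share:
  fixes F :: "'a \<Rightarrow> 'a \<Rightarrow> 'a \<Rightarrow> real"
  shows "(\<Sum>(s, t)\<in>pairs S. \<Sum>(u, v)\<in>pairs S. if s = u then F s t v else 0)
    = (\<Sum>c\<in>S. \<Sum>x\<in>S - {c}. \<Sum>y\<in>S - {c}. F c x y)"
proof -
  have "(\<Sum>(u, v)\<in>pairs S. if s = u then F s t v else 0) = (\<Sum>y\<in>S - {s}. F s t y)" if "s \<in> S" for s t
  proof -
    have "(\<Sum>(u, v)\<in>pairs S. if s = u then F s t v else 0)
      = (\<Sum>u\<in>S. if s = u then (\<Sum>y\<in>S - {u}. F s t y) else 0)"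
      unfolding sum_pairs[OF fin(2)] by (intro sum.cong refl) auto
    thus ?thesis using that fin by simp
  qed
  thus ?thesis unfolding sum_pairs[OF fin(2)] by simp
qed

text \<open>Flipping ordered pairs shows that the four possible coincidences contribute equally,
  whence the factor 4. The diagonal correction costs at most 3 per partner of c.\<close>

lemma variance_le_cov3:
  "swap_moment2 D \<rho> S - (swap_mean D \<rho> S)\<^sup>2 \<le> 4 * (\<Sum>c\<in>S. (\<Sum>x\<in>S - {c}. \<Sum>y\<in>S - {c}. cov3 D \<rho> c x y) + 3 * real (card S))"
proof -
  define H where "H = (\<lambda>c x y. cov3 D \<rho> c x y + (if x = y then 3 else 0))"
  define Z where "Z = (\<Sum>c\<in>S. \<Sum>x\<in>S - {c}. \<Sum>y\<in>S - {c}. H c x y)"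
  let ?P = "pairs S"
  have 1: "(\<Sum>(s, t)\<in>?P. \<Sum>(u, v)\<in>?P. if s = u then H s t v else 0) = Z"
    unfolding Z_def by (rule sum_pairs_share)
  have 2: "(\<Sum>(s, t)\<in>?P. \<Sum>(u, v)\<in>?P. if s = v then H s t u else 0) = Z"
    unfolding 1[symmetric] by (subst (2) sum_pairs_flip) (rule refl)
  have 3: "(\<Sum>(s, t)\<in>?P. \<Sum>(u, v)\<in>?P. if t = u then H t s v else 0) = Z"
    unfolding 1[symmetric] by (subst sum_pairs_flip) (rule refl)
  have 4: "(\<Sum>(s, t)\<in>?P. \<Sum>(u, v)\<in>?P. if t = v then H t s u else 0) = Z"
    unfolding 2[symmetric] by (subst sum_pairs_flip) (rule refl)
  have "swap_moment2 D \<rho> S - (swap_mean D \<rho> S)\<^sup>2 \<le> (\<Sum>(s, t)\<in>?P. \<Sum>(u, v)\<in>?P. (if s = u then H s t v else 0)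
    + (if s = v then H s t u else 0) + (if t = u then H t s v else 0) + (if t = v then H t s u else 0))"
    unfolding variance_eq
  proof (intro sum_mono, clarify)
    fix s t assume st: "(s, t) \<in> ?P"
    show "(\<Sum>(u, v)\<in>?P. pair_cov D \<rho> S s t u v) \<le> (\<Sum>(u, v)\<in>?P. (if s = u then H s t v else 0)
      + (if s = v then H s t u else 0) + (if t = u then H t s v else 0) + (if t = v then H t s u else 0))"
    proof (intro sum_mono, clarify)
      fix u v assume "(u, v) \<in> ?P"
      thus "pair_cov D \<rho> S s t u v \<le> (if s = u then H s t v else 0)
        + (if s = v then H s t u else 0) + (if t = u then H t s v else 0) + (if t = v then H t s u else 0)"
        using st unfolding H_def by (intro pair_cov_le) (auto simp: pairs_def)
    qed
  qed
  also have "\<dots> = 4 * Z"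
    using 1 2 3 4 by (simp add: case_prod_beta sum.distrib)
  also have "Z \<le> (\<Sum>c\<in>S. (\<Sum>x\<in>S - {c}. \<Sum>y\<in>S - {c}. cov3 D \<rho> c x y) + 3 * real (card S))"
    unfolding Z_def
  proof (intro sum_mono)
    fix c assume "c \<in> S"
    have "(\<Sum>x\<in>S - {c}. \<Sum>y\<in>S - {c}. if x = y then 3 else 0) = (\<Sum>x\<in>S - {c}. 3 :: real)"
      using fin by (intro sum.cong refl) simp
    also have "\<dots> \<le> 3 * real (card S)" using card_mono[of S "S - {c}"] fin by simp
    finally show "(\<Sum>x\<in>S - {c}. \<Sum>y\<in>S - {c}. H c x y)
      \<le> (\<Sum>x\<in>S - {c}. \<Sum>y\<in>S - {c}. cov3 D \<rho> c x y) + 3 * real (card S)"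
      unfolding H_def by (simp add: sum.distrib)
  qed
  finally show ?thesis by simp
qed

text \<open>By bilinearity the double sum is the variance, in the state \<open>\<rho> c\<close>, of
  the sum of all the other states. After subtracting \<open>\<kappa>\<close> times the identity that
  observable is the deviation minus \<open>\<rho> c\<close>, and \<open>\<rho> c\<close> has squared
  Frobenius norm at most 1.\<close>

lemma sum_cov3_le:
  assumes "c \<in> S"
  shows "(\<Sum>x\<in>S - {c}. \<Sum>y\<in>S - {c}. cov3 D \<rho> c x y) \<le> 2 * fro2 D (deviation \<rho> S \<kappa>) + 2"
proof -
  define A where "A a b = (\<Sum>x\<in>S - {c}. \<rho> x a b)" for a b
  have "(\<Sum>x\<in>S - {c}. \<Sum>y\<in>S - {c}. cov3 D \<rho> c x y) = Re (tr3 D (\<rho> c) A A) - (Re (tr2 D (\<rho> c) A))\<^sup>2"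
    unfolding A_def tr3_sum_sum tr2_sum_right cov3_def overlap_def
    by (simp add: sum_subtractf power2_eq_square sum_product)
  also have "\<dots> \<le> fro2 D (\<lambda>a b. A a b - scal (of_real \<kappa>) a b)"
    by (rule variance_le_fro2[OF fin(1) trace_state[OF assms] fro2_le[OF assms]])
  also have "(\<lambda>a b. A a b - scal (of_real \<kappa>) a b) = (\<lambda>a b. deviation \<rho> S \<kappa> a b - \<rho> c a b)"
    unfolding A_def deviation_def using fin assms by (simp add: sum_diff1 algebra_simps)
  also have "fro2 D \<dots> \<le> 2 * fro2 D (deviation \<rho> S \<kappa>) + 2 * fro2 D (\<rho> c)" by (rule fro2_diff_le)
  also have "\<dots> \<le> 2 * fro2 D (deviation \<rho> S \<kappa>) + 2" using fro2_le[OF assms] by simp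
  finally show ?thesis .
qed

lemma variance_le:
  "swap_moment2 D \<rho> S - (swap_mean D \<rho> S)\<^sup>2 \<le> 8 * real (card S) * fro2 D (deviation \<rho> S \<kappa>) + 8 * real (card S) + 12 * (real (card S))\<^sup>2"
proof -
  have "swap_moment2 D \<rho> S - (swap_mean D \<rho> S)\<^sup>2 \<le> 4 * (\<Sum>c\<in>S. (2 * fro2 D (deviation \<rho> S \<kappa>) + 2) + 3 * real (card S))"
    by (rule order_trans[OF variance_le_cov3])
      (intro mult_left_mono sum_mono add_mono sum_cov3_le order_refl; simp)
  thus ?thesis by (simp add: algebra_simps power2_eq_square)
qed

text \<open>Restoring the diagonal turns the sum of overlaps into tr (R^2) for the sum R of the
  states. The hypothesis on \<open>\<kappa>\<close> makes the deviation traceless, so R^2 splits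
  without cross terms into the deviation and the identity part.\<close>

lemma mean_eq:
  assumes "\<kappa> * real (card D) = real (card S)"
  shows "swap_mean D \<rho> S = fro2 D (deviation \<rho> S \<kappa>) + \<kappa> * real (card S) - (\<Sum>s\<in>S. fro2 D (\<rho> s))"
proof -
  define R where "R = (\<lambda>a b. \<Sum>r\<in>S. \<rho> r a b)"
  have tr2_R: "tr2 D A R = (\<Sum>s\<in>S. tr2 D A (\<rho> s))" for A
    unfolding R_def by (rule tr2_sum_right)
  have "tr2 D R R = (\<Sum>s\<in>S. tr2 D (\<rho> s) R)"
    unfolding tr2_R[of R] by (intro sum.cong refl tr2_comm)
  hence "(\<Sum>s\<in>S. \<Sum>t\<in>S. overlap D \<rho> s t) = Re (tr2 D R R)"
    by (simp add: tr2_R overlap_def)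
  moreover have "(\<Sum>s\<in>S. \<Sum>t\<in>S. overlap D \<rho> s t) = swap_mean D \<rho> S + (\<Sum>s\<in>S. fro2 D (\<rho> s))"
  proof -
    have "(\<Sum>t\<in>S. overlap D \<rho> s t) = (\<Sum>t\<in>S - {s}. overlap D \<rho> s t) + fro2 D (\<rho> s)" if "s \<in> S" for s
      using that fin by (simp add: sum.remove overlap_def tr2_self hermitian_state)
    thus ?thesis unfolding m1_eq sum_pairs[OF fin(2)] by (simp add: sum.distrib)
  qed
  moreover have "tr2 D R R = of_real (fro2 D (deviation \<rho> S \<kappa>) + \<kappa> * real (card S))"
  proof -
    have R: "R = (\<lambda>a b. deviation \<rho> S \<kappa> a b + scal (of_real \<kappa>) a b)" by (simp add: R_def deviation_def)
    have tr: "(\<Sum>a\<in>D. R a a) = of_nat (card S)"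
      unfolding R_def by (subst sum.swap) (simp add: trace_state)
    have trdev: "(\<Sum>a\<in>D. deviation \<rho> S \<kappa> a a) = 0"
    proof -
      have "(\<Sum>a\<in>D. deviation \<rho> S \<kappa> a a) = (\<Sum>a\<in>D. R a a) - of_real (\<kappa> * real (card D))"
        by (simp add: deviation_def R_def scal_def sum_subtractf mult.commute)
      thus ?thesis by (simp add: tr assms)
    qed
    have herm: "hermitian_on D (deviation \<rho> S \<kappa>)"
      unfolding hermitian_on_def
    proof (intro ballI)
      fix a b assume "a \<in> D" "b \<in> D"
      hence "\<rho> r a b = cnj (\<rho> r b a)" if "r \<in> S" for r
        using hermitian_state[OF that] unfolding hermitian_on_def by blast
      thus "deviation \<rho> S \<kappa> a b = cnj (deviation \<rho> S \<kappa> b a)" by (simp add: deviation_def scal_def)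
    qed
    have "tr2 D R R = tr2 D R (deviation \<rho> S \<kappa>) + of_real \<kappa> * of_nat (card S)"
      by (subst (2) R) (simp add: tr2_add_right tr2_scal fin tr)
    also have "tr2 D R (deviation \<rho> S \<kappa>) = tr2 D (deviation \<rho> S \<kappa>) R" by (rule tr2_comm)
    also have "\<dots> = of_real (fro2 D (deviation \<rho> S \<kappa>))"
      by (subst R) (simp add: tr2_add_right tr2_scal fin trdev tr2_self[OF herm])
    finally show ?thesis by simp
  qed
  ultimately show ?thesis by simp
qed

lemma mean_bounds:
  assumes "\<kappa> * real (card D) = real (card S)"
  shows "fro2 D (deviation \<rho> S \<kappa>) - real (card S) \<le> swap_mean D \<rho> S - \<kappa> * real (card S)"
    "swap_mean D \<rho> S - \<kappa> * real (card S) \<le> fro2 D (deviation \<rho> S \<kappa>)"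
proof -
  have "0 \<le> (\<Sum>s\<in>S. fro2 D (\<rho> s))" by (intro sum_nonneg fro2_nonneg)
  moreover have "(\<Sum>s\<in>S. fro2 D (\<rho> s)) \<le> (\<Sum>s\<in>S. 1)" by (intro sum_mono fro2_le)
  ultimately show "fro2 D (deviation \<rho> S \<kappa>) - real (card S) \<le> swap_mean D \<rho> S - \<kappa> * real (card S)"
    "swap_mean D \<rho> S - \<kappa> * real (card S) \<le> fro2 D (deviation \<rho> S \<kappa>)"
    unfolding mean_eq[OF assms] by simp_all
qed

end

section \<open>The test\<close>

text \<open>Multiply the Cholesky factors of the single states and expand the product of sums; the
  vectors are then labelled by the functions choosing one summand in each factor.\<close>

lemma product_state_factorization:
  assumes fin: "finite S" "finite D" and psd: "\<And>t. t \<in> S \<Longrightarrow> psd_on D (\<rho> t)"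
  obtains u where "\<And>f g. f \<in> S \<rightarrow>\<^sub>E D \<Longrightarrow> g \<in> S \<rightarrow>\<^sub>E D \<Longrightarrow>
    product_state S \<rho> f g = (\<Sum>\<kappa>\<in>S \<rightarrow>\<^sub>E D. u \<kappa> f * cnj (u \<kappa> g))"
proof -
  have "\<forall>t\<in>S. \<exists>c. \<forall>a\<in>D. \<forall>b\<in>D. \<rho> t a b = (\<Sum>k\<in>D. c k a * cnj (c k b))"
    using psd_on_factorization[OF fin(2) psd] by blast
  then obtain c where c: "\<forall>t\<in>S. \<forall>a\<in>D. \<forall>b\<in>D. \<rho> t a b = (\<Sum>k\<in>D. c t k a * cnj (c t k b))"
    by (rule bchoice[THEN exE])
  define u where "u \<kappa> f = (\<Prod>t\<in>S. c t (\<kappa> t) (f t))" for \<kappa> f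
  have "product_state S \<rho> f g = (\<Sum>\<kappa>\<in>S \<rightarrow>\<^sub>E D. u \<kappa> f * cnj (u \<kappa> g))"
    if fg: "f \<in> S \<rightarrow>\<^sub>E D" "g \<in> S \<rightarrow>\<^sub>E D" for f g
  proof -
    have "product_state S \<rho> f g = (\<Prod>t\<in>S. \<Sum>k\<in>D. c t k (f t) * cnj (c t k (g t)))"
      unfolding product_state_def
    proof (intro prod.cong refl)
      fix t assume "t \<in> S"
      thus "\<rho> t (f t) (g t) = (\<Sum>k\<in>D. c t k (f t) * cnj (c t k (g t)))"
        using c PiE_mem[OF fg(1)] PiE_mem[OF fg(2)] by blast
    qed
    also have "\<dots> = (\<Sum>\<kappa>\<in>S \<rightarrow>\<^sub>E D. \<Prod>t\<in>S. c t (\<kappa> t) (f t) * cnj (c t (\<kappa> t) (g t)))"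
      by (rule prod_sum_PiE) (use fin in auto)
    finally show ?thesis by (simp add: u_def prod.distrib)
  qed
  thus ?thesis using that by blast
qed

lemma sum_digits:
  assumes "d \<ge> 1"
  shows "(\<Sum>i<d ^ T. F (digits d T i)) = (\<Sum>g\<in>{..<T} \<rightarrow>\<^sub>E {..<d}. F g)"
  by (rule sum.reindex_bij_betw[OF bij_betw_digits[OF assms]])

lemma ex_digits:
  assumes d: "d \<ge> 1"
    and Q: "\<And>i j. i < d ^ T \<Longrightarrow> j < d ^ T \<Longrightarrow> Q i j = P (digits d T i) (digits d T j)"
  shows "ex1 {..<d ^ T} (\<lambda>i j. X (digits d T i) (digits d T j)) Q = ex1 ({..<T} \<rightarrow>\<^sub>E {..<d}) X P"
    and "ex2 {..<d ^ T} (\<lambda>i j. X (digits d T i) (digits d T j)) Q = ex2 ({..<T} \<rightarrow>\<^sub>E {..<d}) X P"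
proof -
  let ?g = "digits d T" and ?N = "d ^ T"
  have "ex1 {..<?N} (\<lambda>i j. X (?g i) (?g j)) Q = (\<Sum>i<?N. \<Sum>j<?N. X (?g i) (?g j) * P (?g j) (?g i))"
    unfolding ex1_def by (intro sum.cong refl) (simp add: Q)
  also have "\<dots> = ex1 ({..<T} \<rightarrow>\<^sub>E {..<d}) X P"
    unfolding ex1_def sum_digits[OF d, symmetric] ..
  finally show "ex1 {..<?N} (\<lambda>i j. X (?g i) (?g j)) Q = ex1 ({..<T} \<rightarrow>\<^sub>E {..<d}) X P" .
  have "ex2 {..<?N} (\<lambda>i j. X (?g i) (?g j)) Q =
    (\<Sum>i<?N. \<Sum>j<?N. \<Sum>k<?N. X (?g i) (?g k) * X (?g k) (?g j) * P (?g j) (?g i))"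
    unfolding ex2_def by (intro sum.cong refl) (simp add: Q)
  also have "\<dots> = ex2 ({..<T} \<rightarrow>\<^sub>E {..<d}) X P"
    unfolding ex2_def sum_digits[OF d, symmetric] ..
  finally show "ex2 {..<?N} (\<lambda>i j. X (?g i) (?g j)) Q = ex2 ({..<T} \<rightarrow>\<^sub>E {..<d}) X P" .
qed

text \<open>The factor 4 undoes the half in the trace distance, and d is the price of passing from
  the trace norm to the Frobenius norm.\<close>

lemma rho_avg_deviation:
  fixes \<rho> :: "nat \<Rightarrow> complex mat"
  assumes "d \<ge> 1" "T > 0"
  defines "F \<equiv> fro2 {..<d} (deviation (\<lambda>t a b. \<rho> t $$ (a, b)) {..<T} (real T / real d))"
  shows "rho_avg d T \<rho> = max_mixed d \<Longrightarrow> F = 0"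
    and "4 * (real T)\<^sup>2 * (trace_dist (rho_avg d T \<rho>) (max_mixed d))\<^sup>2 \<le> real d * F"
proof -
  let ?A = "rho_avg d T \<rho> - max_mixed d"
  have A: "?A \<in> carrier_mat d d" by (auto simp: rho_avg_def max_mixed_def)
  have dev: "deviation (\<lambda>t a b. \<rho> t $$ (a, b)) {..<T} (real T / real d) a b = of_nat T * ?A $$ (a, b)"
    if "a < d" "b < d" for a b
    using that assms(1,2) by (simp add: deviation_def scal_def rho_avg_def max_mixed_def field_simps)
  have F: "F = (real T)\<^sup>2 * fro2 {..<d} (\<lambda>i j. ?A $$ (i, j))"
    unfolding F_def fro2_def sum_distrib_left
    by (intro sum.cong refl) (simp add: dev norm_mult power_mult_distrib)
  {
    assume "rho_avg d T \<rho> = max_mixed d"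
    thus "F = 0" unfolding F fro2_def by (simp add: max_mixed_def)
  }
  have "4 * (real T)\<^sup>2 * (trace_dist (rho_avg d T \<rho>) (max_mixed d))\<^sup>2 = (real T)\<^sup>2 * (trace_norm ?A)\<^sup>2"
    unfolding trace_dist_def by (simp add: power_divide)
  also have "\<dots> \<le> (real T)\<^sup>2 * (real d * fro2 {..<d} (\<lambda>i j. ?A $$ (i, j)))"
    by (intro mult_left_mono trace_norm_sq_le A) simp
  finally show "4 * (real T)\<^sup>2 * (trace_dist (rho_avg d T \<rho>) (max_mixed d))\<^sup>2 \<le> real d * F"
    by (simp add: F mult_ac)
qed

lemma swap_test:
  assumes d: "d \<ge> 1" and T: "T > 0"
  shows "\<exists>M. accept_effect (d ^ T) M \<and> (\<forall>\<rho>. (\<forall>t<T. density_mat d (\<rho> t)) \<longrightarrow>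
    (let F = fro2 {..<d} (deviation (\<lambda>t a b. \<rho> t $$ (a, b)) {..<T} (real T / real d));
         p = accept_prob M (tensor_all T \<rho>)
     in (F = 0 \<longrightarrow> p \<ge> 0.99) \<and> (F \<ge> 4000 * real T \<longrightarrow> 1 - p \<ge> 0.99)))"
proof -
  let ?S = "{..<T}" and ?D = "{..<d}" and ?N = "d ^ T" and ?g = "digits d T"
  define X where "X i j = swap_sum ?S (?g i) (?g j)" for i j
  \<comment> \<open>For F = 0 the exact mean is \<open>\<theta>\<close> minus the sum of the
    purities tr (\<rho>_t^2). That sum is unknown but lies between 0 and T, so this centre has a
    bias of at most T.\<close>
  define \<theta> where "\<theta> = real T / real d * real T"
  \<comment> \<open>For F = 0 the second moment about \<open>\<theta>\<close> is at most 20 T^2 +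
    T^2, so the factor 50 gives the error bound 21/2500, below 0.01.\<close>
  define \<sigma> where "\<sigma> = 50 * real T"
  have herm: "hermitian_on {..<?N} X"
    using hermitian_swap_sum[of UNIV ?S] unfolding hermitian_on_def X_def by blast
  have \<sigma>: "\<sigma> > 0" using T by (simp add: \<sigma>_def)
  obtain M where eff: "accept_effect ?N M" and
    M: "\<forall>P (K :: (nat \<Rightarrow> nat) set) u. P \<in> carrier_mat ?N ?N \<longrightarrow>
      (\<forall>i<?N. \<forall>j<?N. P $$ (i, j) = (\<Sum>\<kappa>\<in>K. u \<kappa> i * cnj (u \<kappa> j))) \<longrightarrow> mtrace P = 1 \<longrightarrow>
      (let m1 = Re (ex1 {..<?N} X (\<lambda>i j. P $$ (i, j))); m2 = Re (ex2 {..<?N} X (\<lambda>i j. P $$ (i, j)))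
       in \<sigma>\<^sup>2 * (1 - accept_prob M P) \<le> m2 - 2 * \<theta> * m1 + \<theta>\<^sup>2 \<and>
         (\<theta> < m1 \<longrightarrow> (m1 - \<theta>)\<^sup>2 * accept_prob M P \<le> 2 * (m2 - m1\<^sup>2 + \<sigma>\<^sup>2)))"
    using test_effect_exists[OF herm \<sigma>, where \<theta> = \<theta>] by blast
  have "(F = 0 \<longrightarrow> p \<ge> 0.99) \<and> (F \<ge> 4000 * real T \<longrightarrow> 1 - p \<ge> 0.99)"
    if \<rho>: "\<forall>t<T. density_mat d (\<rho> t)"
      and F: "F = fro2 {..<d} (deviation (\<lambda>t a b. \<rho> t $$ (a, b)) {..<T} (real T / real d))"
      and p: "p = accept_prob M (tensor_all T \<rho>)" for \<rho> F p
  proof -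
    define r where "r t a b = \<rho> t $$ (a, b)" for t a b
    let ?P = "tensor_all T \<rho>"
    have st: "state_on ?D (r t)" if "t \<in> ?S" for t
      using density_mat_state_on(1) \<rho> that unfolding r_def by blast
    have car: "\<rho> t \<in> carrier_mat d d" if "t < T" for t using density_mat_state_on(2) \<rho> that by blast
    have P: "?P \<in> carrier_mat ?N ?N" by (rule tensor_all_entries(1)[OF car])
    have Pent: "?P $$ (i, j) = product_state ?S r (?g i) (?g j)" if "i < ?N" "j < ?N" for i j
      unfolding product_state_def r_def by (rule tensor_all_entries(2)[OF car that])
    have gPi: "?g i \<in> ?S \<rightarrow>\<^sub>E ?D" if "i < ?N" for i
      using bij_betw_digits[OF d, of T] that unfolding bij_betw_def by auto
    obtain u where u: "\<And>f g. f \<in> ?S \<rightarrow>\<^sub>E ?D \<Longrightarrow> g \<in> ?S \<rightarrow>\<^sub>E ?D \<Longrightarrow>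
      product_state ?S r f g = (\<Sum>\<kappa>\<in>?S \<rightarrow>\<^sub>E ?D. u \<kappa> f * cnj (u \<kappa> g))"
      using product_state_factorization[of ?S ?D r] st unfolding state_on_def by auto
    have Pu: "\<forall>i<?N. \<forall>j<?N. ?P $$ (i, j) = (\<Sum>\<kappa>\<in>?S \<rightarrow>\<^sub>E ?D. u \<kappa> (?g i) * cnj (u \<kappa> (?g j)))"
      by (simp add: Pent u gPi)
    have "mtrace ?P = (\<Sum>i<?N. product_state ?S r (?g i) (?g i))"
      unfolding mtrace_def carrier_matD(1)[OF P] by (intro sum.cong refl) (simp add: Pent)
    also have "\<dots> = (\<Sum>g\<in>?S \<rightarrow>\<^sub>E ?D. product_state ?S r g g)"
      by (rule sum_digits[OF d])
    \<comment> \<open>A trace is the value of the identity permutation, for which all factors are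
      fixed points.\<close>
    also have "\<dots> = perm_val ?D r ?S (\<lambda>t. t)"
      by (simp add: perm_val_def product_state_def)
    also have "\<dots> = 1"
      by (rule perm_val_fixed) (use st in \<open>auto simp: state_on_def\<close>)
    finally have tr: "mtrace ?P = 1" .
    define \<mu> where "\<mu> = swap_mean ?D r ?S"
    define v where "v = swap_moment2 ?D r ?S"
    have "Re (ex1 {..<?N} X (\<lambda>i j. ?P $$ (i, j))) = \<mu>"
      unfolding X_def \<mu>_def swap_mean_def by (rule arg_cong[where f = Re], rule ex_digits(1)[OF d], rule Pent)
    moreover have "Re (ex2 {..<?N} X (\<lambda>i j. ?P $$ (i, j))) = v"
      unfolding X_def v_def swap_moment2_def by (rule arg_cong[where f = Re], rule ex_digits(2)[OF d], rule Pent)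
    ultimately have acc: "\<sigma>\<^sup>2 * (1 - p) \<le> v - 2 * \<theta> * \<mu> + \<theta>\<^sup>2"
      and rej: "\<theta> < \<mu> \<Longrightarrow> (\<mu> - \<theta>)\<^sup>2 * p \<le> 2 * (v - \<mu>\<^sup>2 + \<sigma>\<^sup>2)"
      using M[THEN spec, of ?P, THEN spec, of "?S \<rightarrow>\<^sub>E ?D", THEN spec, of "\<lambda>\<kappa> i. u \<kappa> (?g i)",
          THEN mp, OF P, THEN mp, OF Pu, THEN mp, OF tr]
      unfolding Let_def p by auto
    have F': "F = fro2 ?D (deviation r ?S (real T / real d))" unfolding F r_def ..
    have fin: "finite ?D" "finite ?S" by auto
    have \<kappa>: "real T / real d * real (card ?D) = real (card ?S)" using d by simp
    have mean: "F - real T \<le> \<mu> - \<theta>" "\<mu> - \<theta> \<le> F"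
      using mean_bounds[OF fin st \<kappa>] unfolding F' \<mu>_def \<theta>_def by simp_all
    have "v - \<mu>\<^sup>2 \<le> 8 * real T * F + 8 * real T + 12 * (real T)\<^sup>2"
      using variance_le[OF fin st, where \<kappa> = "real T / real d"] unfolding F' \<mu>_def v_def by simp
    moreover have "real T \<le> (real T)\<^sup>2" using T by (simp add: power2_eq_square)
    ultimately have var: "v - \<mu>\<^sup>2 \<le> 8 * real T * F + 20 * (real T)\<^sup>2" by linarith
    have T2: "(real T)\<^sup>2 > 0" using T by simp
    show ?thesis
    proof (intro conjI impI)
      assume "F = 0"
      hence "\<bar>\<mu> - \<theta>\<bar> \<le> real T" using mean by linarith
      hence "(\<mu> - \<theta>)\<^sup>2 \<le> (real T)\<^sup>2" by (metis abs_le_square_iff abs_of_nat)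
      moreover have "v - 2 * \<theta> * \<mu> + \<theta>\<^sup>2 = (v - \<mu>\<^sup>2) + (\<mu> - \<theta>)\<^sup>2"
        by (simp add: power2_eq_square algebra_simps)
      ultimately have "\<sigma>\<^sup>2 * (1 - p) \<le> 21 * (real T)\<^sup>2" using acc var \<open>F = 0\<close> by simp
      hence "(real T)\<^sup>2 * (2500 * (1 - p)) \<le> (real T)\<^sup>2 * 21" by (simp add: \<sigma>_def power_mult_distrib algebra_simps)
      hence "2500 * (1 - p) \<le> 21" using T2 by (rule mult_left_le_imp_le)
      thus "p \<ge> 0.99" by simp
    next
      assume FT: "F \<ge> 4000 * real T"
      have T1: "real T > 0" using T by simp
      \<comment> \<open>Measuring F in units of T cancels T from the final inequality.\<close>
      define y where "y = F / real T"
      have Fy: "F = y * real T" and y: "y \<ge> 4000" using FT T1 by (auto simp: y_def field_simps)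
      have gap: "(y - 1) * real T \<le> \<mu> - \<theta>" using mean(1) by (simp add: Fy algebra_simps)
      have gap0: "0 < (y - 1) * real T" using y T1 by simp
      show "1 - p \<ge> 0.99"
      proof (rule ccontr)
        assume "\<not> 1 - p \<ge> 0.99"
        hence p: "p > 0.01" by simp
        have "((y - 1) * real T)\<^sup>2 * 0.01 \<le> (\<mu> - \<theta>)\<^sup>2 * p"
          using gap gap0 p by (intro mult_mono power_mono) auto
        also have "\<dots> \<le> 2 * (v - \<mu>\<^sup>2 + \<sigma>\<^sup>2)" using gap gap0 by (intro rej) linarith
        also have "\<dots> \<le> 2 * (8 * real T * F + 20 * (real T)\<^sup>2 + \<sigma>\<^sup>2)" using var by simp
        also have "\<dots> = (real T)\<^sup>2 * (16 * y + 5040)"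
          by (simp add: Fy \<sigma>_def power2_eq_square algebra_simps)
        finally have "(real T)\<^sup>2 * ((y - 1)\<^sup>2 * 0.01) \<le> (real T)\<^sup>2 * (16 * y + 5040)"
          by (simp add: power_mult_distrib mult_ac)
        hence "(y - 1)\<^sup>2 * 0.01 \<le> 16 * y + 5040" using T2 by (rule mult_left_le_imp_le)
        \<comment> \<open>A linear lower bound is enough: 39.98 y exceeds 16 y + 5040 from y = 4000
          on. Here 16 = 2 * 8 and 5040 = 2 * (20 + 50^2).\<close>
        moreover have "(y - 1)\<^sup>2 \<ge> 3998 * y"
        proof -
          have "4000 * y \<le> y * y" using y by (intro mult_right_mono) auto
          thus ?thesis by (simp add: power2_eq_square algebra_simps)
        qed
        ultimately show False using y by simp
      qed
    qed
  qed
  thus ?thesis using eff unfolding Let_def by blast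
qed

theorem theorem2p3:
  shows "\<exists>K :: real. K > 0 \<and>
    (\<forall>(d :: nat) (\<epsilon> :: real) (T :: nat).
       d \<ge> 1 \<longrightarrow> \<epsilon> > 0 \<longrightarrow> real T \<ge> K * real d / \<epsilon>\<^sup>2 \<longrightarrow>
       (\<exists>M. accept_effect (d ^ T) M \<and>
          (\<forall>\<rho> :: nat \<Rightarrow> complex mat. (\<forall>t < T. density_mat d (\<rho> t)) \<longrightarrow>
             (rho_avg d T \<rho> = max_mixed d \<longrightarrow> accept_prob M (tensor_all T \<rho>) \<ge> 0.99) \<and>
             (trace_dist (rho_avg d T \<rho>) (max_mixed d) > \<epsilon> \<longrightarrow>
                1 - accept_prob M (tensor_all T \<rho>) \<ge> 0.99))))"
proof (intro exI[of _ "1000 :: real"] conjI allI impI)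
  fix d T :: nat and \<epsilon> :: real
  assume d: "d \<ge> 1" and \<epsilon>: "\<epsilon> > 0" and T: "real T \<ge> 1000 * real d / \<epsilon>\<^sup>2"
  \<comment> \<open>The lower bound on T is positive, which rules out the degenerate case T =
    0.\<close>
  have "1000 * real d / \<epsilon>\<^sup>2 > 0" using d \<epsilon> by simp
  hence T0: "T > 0" using T by (metis less_le_trans of_nat_0_less_iff)
  have T\<epsilon>: "1000 * real d \<le> real T * \<epsilon>\<^sup>2" using T \<epsilon> by (simp add: field_simps)
  obtain M where eff: "accept_effect (d ^ T) M" and
    M: "\<And>\<rho>. (\<forall>t<T. density_mat d (\<rho> t)) \<Longrightarrow>
    (let F = fro2 {..<d} (deviation (\<lambda>t a b. \<rho> t $$ (a, b)) {..<T} (real T / real d));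
         p = accept_prob M (tensor_all T \<rho>)
     in (F = 0 \<longrightarrow> p \<ge> 0.99) \<and> (F \<ge> 4000 * real T \<longrightarrow> 1 - p \<ge> 0.99))"
    using swap_test[OF d T0] by blast
  have "(rho_avg d T \<rho> = max_mixed d \<longrightarrow> accept_prob M (tensor_all T \<rho>) \<ge> 0.99) \<and>
      (trace_dist (rho_avg d T \<rho>) (max_mixed d) > \<epsilon> \<longrightarrow> 1 - accept_prob M (tensor_all T \<rho>) \<ge> 0.99)"
    if \<rho>: "\<forall>t<T. density_mat d (\<rho> t)" for \<rho>
  proof -
    define F where "F = fro2 {..<d} (deviation (\<lambda>t a b. \<rho> t $$ (a, b)) {..<T} (real T / real d))"
    note dv = rho_avg_deviation[OF d T0, of \<rho>, folded F_def]
    have "F \<ge> 4000 * real T" if tdist: "trace_dist (rho_avg d T \<rho>) (max_mixed d) > \<epsilon>"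
    proof -
      \<comment> \<open>The threshold 4000 is 4 K for K = 1000, the 4 coming from the half in the
        trace distance.\<close>
      have "real d * (4000 * real T) = 4 * real T * (1000 * real d)" by simp
      also have "\<dots> \<le> 4 * real T * (real T * \<epsilon>\<^sup>2)" using T\<epsilon> by (intro mult_left_mono) auto
      also have "\<dots> = 4 * (real T)\<^sup>2 * \<epsilon>\<^sup>2" by (simp add: power2_eq_square)
      also have "\<dots> \<le> 4 * (real T)\<^sup>2 * (trace_dist (rho_avg d T \<rho>) (max_mixed d))\<^sup>2"
        using tdist \<epsilon> by (intro mult_left_mono power_mono) auto
      also have "\<dots> \<le> real d * F" by (rule dv(2))
      finally show ?thesis using d by simp
    qed
    thus ?thesis using M[OF \<rho>, folded F_def] dv(1) unfolding Let_def by blast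
  qed
  thus "\<exists>M. accept_effect (d ^ T) M \<and>
      (\<forall>\<rho> :: nat \<Rightarrow> complex mat. (\<forall>t < T. density_mat d (\<rho> t)) \<longrightarrow>
         (rho_avg d T \<rho> = max_mixed d \<longrightarrow> accept_prob M (tensor_all T \<rho>) \<ge> 0.99) \<and>
         (trace_dist (rho_avg d T \<rho>) (max_mixed d) > \<epsilon> \<longrightarrow>
            1 - accept_prob M (tensor_all T \<rho>) \<ge> 0.99))"
    using eff by blast
qed simp

end
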